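(* Let $m\in\mathbb{N}_0=\{0,1,2,\dots\}$ and let $x$ be real. Then $$(-1)^{m}e^{x}\int_{0}^{\infty}t^m\, \bar{\psi}_{m}(t)\,e^{-\pi t^2e^{4x}}\,dt=\frac{1}{2}\int_{0}^{\infty}\frac{\Xi(t)}{\cosh(\pi t)\left(t^2+\frac{1}{4}\right)}\left(\frac{\Gamma(\frac{1}{2}-it+m)}{\Gamma(\frac{1}{2}-it)}e^{-2ixt}+\frac{\Gamma(\frac{1}{2}+it+m)}{\Gamma(\frac{1}{2}+it)}e^{2ixt}\right)dt,$$ where, for $t>0$, $$\bar{\psi}_{m}(t):=\frac{\partial^m }{\partial t^m}\bigl(\psi(t+1)-\log(t)\bigr).$$
   Context: $\Gamma$ is the gamma function and $\psi(x)=\frac{d}{dx}\log\Gamma(x)$ is the digamma function. $\zeta$ is the Riemann zeta function (analytically continued), $\xi(s):=\frac{1}{2}s(s-1)\pi^{-s/2}\Gamma(\frac{s}{2})\zeta(s)$ (an entire function satisfying $\xi(s)=\xi(1-s)$), and $\Xi(t):=\xi(\frac12+it)$. *)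

theory Defs
  imports "HOL-Complex_Analysis.Complex_Analysis"
begin

text \<open>
  The continuation is unique on the connected open set \<open>- {1}\<close>, so the choice below determines
  every value except the one at the pole \<open>1\<close>, which is unspecified and carries no meaning.
\<close>

definition riemann_zeta :: "complex \<Rightarrow> complex" where
  "riemann_zeta = (SOME f. f holomorphic_on (- {1}) \<and>
     (\<forall>s. Re s > 1 \<longrightarrow> (\<lambda>n. 1 / of_nat (Suc n) powr s) sums f s))"

text \<open>
  The bare product below has removable singularities at \<open>0\<close>, \<open>1\<close> and the negative even integers
  (in HOL, \<^const>\<open>Gamma\<close> is \<open>0\<close> at its poles); filling them in gives the entire function \<open>\<xi>\<close>.
\<close>

definition riemann_xi :: "complex \<Rightarrow> complex" where
  "riemann_xi = remove_sings
     (\<lambda>s. 1 / 2 * s * (s - 1) * of_real pi powr (- s / 2) * Gamma (s / 2) * riemann_zeta s)"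

definition riemann_Xi :: "complex \<Rightarrow> complex" where
  "riemann_Xi t = riemann_xi (1 / 2 + \<i> * t)"

definition psi_bar :: "nat \<Rightarrow> real \<Rightarrow> real" where
  "psi_bar m = (deriv ^^ m) (\<lambda>t. Digamma (t + 1) - ln t)"

end

theory Submission
  imports Defs "HOL-Probability.Sinc_Integral" "HOL-Probability.Characteristic_Functions" "HOL-Real_Asymp.Real_Asymp"
begin

text \<open>
  Every quantity in the identity is an integral against one function. Put
  \<open>\<omega>(v) = \<Sum>n\<ge>1. exp (- \<pi> n\<^sup>2 v\<^sup>2)\<close> (\<open>gauss_sum\<close>), \<open>h(v) = 1/(2v) - \<omega>(v)\<close> (\<open>gauss_defect\<close>) and
  \<open>H(u) = exp (u/2) h(exp u)\<close> (\<open>xi_kernel\<close>). Both sides equal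
  \<open>1/2 \<integral> H(u) K(2x - u) du\<close> over the real line, where \<open>K(v) = 2 m! exp (v/2) / (1 + exp v)^(m+1)\<close>.

  On the right, \<open>\<Xi>(t) / (t\<^sup>2 + 1/4)\<close> is the Fourier transform of \<open>H\<close> (\<open>riemann_Xi_fourier\<close>): the Mellin
  transform of \<open>h\<close> on the critical line is \<open>- 1/2 \<pi>^(-s/2) \<Gamma>(s/2) \<zeta>(s)\<close>. The quotient of Gamma values is the
  Pochhammer symbol \<open>(1/2 + it)\<^sub>m\<close>, and the Fourier transform of \<open>(1/2 + it)\<^sub>m / cosh (\<pi> t)\<close> is \<open>K\<close>
  (\<open>fourier_sech_poly\<close>). The reciprocity law of the theta function (\<open>gauss_sum_reciprocity\<close>) says that
  \<open>H\<close> is even. Hence so is \<open>\<Xi>\<close>, the two halves of the integrand unfold to one integral over the real line,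
  and Fubini's theorem evaluates it (\<open>xi_sech_fubini\<close>).

  On the left, the point is that \<open>h(v)\<close> and \<open>(-1)^m t^m psi_bar m t\<close> have the same shape. Both are
  ``integral over the half-line minus sum over the positive integers'' of a decreasing function of \<open>u\<close>: of
  \<open>exp (- \<pi> u\<^sup>2 v\<^sup>2)\<close> in the first case, of \<open>m! t^m / (u + t)^(m+1)\<close> in the second. With \<open>b = exp (2x)\<close>, the
  substitution \<open>t = u v / b\<close>, for each fixed \<open>u\<close>, turns the integral of the second function against the Gaussian
  \<open>exp (- \<pi> b\<^sup>2 t\<^sup>2)\<close> into that of the first one against \<open>m! v^m / (b + v)^(m+1)\<close>. Because the functions decrease,
  only nonnegative quantities are summed, so Tonelli's theorem passes from fixed \<open>u\<close> to the difference of integral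
  and sum (\<open>nn_integral_psi_bar_gaussian\<close>). Finally \<open>v = exp u\<close> produces \<open>H\<close> and \<open>K\<close>.

  The zeta function is given as some analytic continuation of the Dirichlet series. That one exists is shown by
  Riemann's formula, again from the reciprocity law, and the identity theorem identifies the two (\<open>riemann_zeta_eq\<close>).
\<close>

section \<open>Reciprocity for the Gaussian theta series\<close>

definition gauss_sum :: "real \<Rightarrow> real" where
  "gauss_sum v = (\<Sum>n. exp (- pi * (real (Suc n))\<^sup>2 * v\<^sup>2))"

definition gauss_defect :: "real \<Rightarrow> real" where
  "gauss_defect v = 1 / (2 * v) - gauss_sum v"

text \<open>
  Crude, but it reduces every question of convergence for Gaussian sums to the series of \<open>1/n\<^sup>2\<close>.
  It comes from \<open>exp y \<ge> y\<^sup>2 / 2\<close> for \<open>y \<ge> 0\<close>.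
\<close>
lemma gauss_term_bound:
  fixes c x :: real
  assumes "c > 0" "x \<ge> 1"
  shows "x * exp (- c * x\<^sup>2) \<le> 2 / c\<^sup>2 * (1 / x\<^sup>2)"
proof -
  have "(c*x\<^sup>2)\<^sup>2 / 2 \<le> exp (c * x\<^sup>2)"
    using exp_lower_Taylor_quadratic[of "c*x\<^sup>2"] zero_le_power2[of x] assms
    by (smt (verit) mult_nonneg_nonneg)
  hence "x * exp (- c * x\<^sup>2) \<le> x * (2 / (c*x\<^sup>2)\<^sup>2)"
    using assms by (intro mult_left_mono) (auto simp: exp_minus field_simps)
  also have "\<dots> = 2 / c\<^sup>2 * (1 / x ^ 3)"
    using assms by (simp add: field_simps power2_eq_square power3_eq_cube)
  also have "\<dots> \<le> 2 / c\<^sup>2 * (1 / x\<^sup>2)"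
    using assms by (intro mult_left_mono divide_left_mono power_increasing) auto
  finally show ?thesis .
qed

lemma summable_gauss_linear:
  assumes "c > 0"
  shows "summable (\<lambda>n. real (Suc n) * exp (- c * (real (Suc n))\<^sup>2))"
proof (rule summable_comparison_test_ev)
  show "summable (\<lambda>n. 2 / c\<^sup>2 * (1 / (real (Suc n))\<^sup>2))"
    using inverse_power_summable[of 2, where 'a=real]
    by (intro summable_mult, subst summable_Suc_iff) (simp add: field_simps)
qed (use gauss_term_bound[OF assms] in \<open>auto intro!: always_eventually\<close>)

lemma summable_gauss:
  assumes "c > 0"
  shows "summable (\<lambda>n. exp (- c * (real (Suc n))\<^sup>2))"
  by (rule summable_comparison_test[OF _ summable_gauss_linear[OF assms]])
     (auto intro!: exI[of _ 0])

text \<open>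
  Up to scaling this is the characteristic function of the standard normal distribution.
\<close>
lemma gaussian_fourier:
  assumes "v > (0::real)"
  shows "integrable lborel (\<lambda>x. exp (- pi * x\<^sup>2 * v\<^sup>2))"
    and "(\<integral>x. exp (- pi * x\<^sup>2 * v\<^sup>2) * cos (2 * pi * k * x) \<partial>lborel) = exp (- pi * k\<^sup>2 / v\<^sup>2) / v"
proof -
  define c where "c = v * sqrt (2 * pi)"
  have c: "c > 0" using assms by (simp add: c_def)
  have c2: "c\<^sup>2 = 2 * pi * v\<^sup>2" by (simp add: c_def power_mult_distrib)
  have dens: "std_normal_density (c * x) = exp (- pi * x\<^sup>2 * v\<^sup>2) / sqrt (2 * pi)" for x
    by (simp add: std_normal_density_def power_mult_distrib c2 mult_ac)
  have "integrable lborel std_normal_density" by simp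
  hence "integrable lborel (\<lambda>x. std_normal_density (c * x))"
    using lborel_integrable_real_affine[of std_normal_density c 0] c by simp
  hence "integrable lborel (\<lambda>x. sqrt (2 * pi) * std_normal_density (c * x))" by simp
  thus "integrable lborel (\<lambda>x. exp (- pi * x\<^sup>2 * v\<^sup>2))" by (simp add: dens)
  have "exp (- (2 * pi * k / c)\<^sup>2 / 2) = Re (char std_normal_distribution (2 * pi * k / c))"
    by (simp only: char_std_normal_distribution Re_complex_of_real)
  also have "\<dots> = Re (\<integral>x. std_normal_density x *\<^sub>R iexp (2 * pi * k / c * x) \<partial>lborel)"
    unfolding char_def by (subst integral_density) auto
  also have "\<dots> = (\<integral>x. Re (std_normal_density x *\<^sub>R iexp (2 * pi * k / c * x)) \<partial>lborel)"
  proof (rule integral_Re[symmetric])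
    show "complex_integrable lborel (\<lambda>x. std_normal_density x *\<^sub>R iexp (2 * pi * k / c * x))"
      by (rule Bochner_Integration.integrable_bound[of _ std_normal_density]) auto
  qed
  also have "\<dots> = (\<integral>x. std_normal_density x * cos (2 * pi * k / c * x) \<partial>lborel)"
    by (simp add: Re_exp)
  also have "\<dots> = c * (\<integral>x. std_normal_density (c * x) * cos (2 * pi * k * x) \<partial>lborel)"
    using lborel_integral_real_affine[of c "\<lambda>x. std_normal_density x * cos (2 * pi * k / c * x)" 0] c
    by (simp add: mult.assoc)
  also have "\<dots> = v * (\<integral>x. exp (- pi * x\<^sup>2 * v\<^sup>2) * cos (2 * pi * k * x) \<partial>lborel)"
    using c assms unfolding dens by (simp add: c_def mult_ac)
  also have "- (2 * pi * k / c)\<^sup>2 / 2 = - pi * k\<^sup>2 / v\<^sup>2"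
    unfolding power_divide c2 using assms by (simp add: field_simps power2_eq_square)
  finally show "(\<integral>x. exp (- pi * x\<^sup>2 * v\<^sup>2) * cos (2 * pi * k * x) \<partial>lborel) = exp (- pi * k\<^sup>2 / v\<^sup>2) / v"
    using assms by (simp add: field_simps)
qed

text \<open>
  This is Bessel's inequality: expanding the integral of \<open>(c g - \<Sum> a\<^sub>k e\<^sub>k)\<^sup>2 \<ge> 0\<close> bounds \<open>\<Sum> a\<^sub>k\<^sup>2\<close>.
  For sines it is the Riemann--Lebesgue lemma for square-integrable functions.
\<close>
lemma bessel_tendsto_0:
  fixes g :: "'a \<Rightarrow> real" and e :: "nat \<Rightarrow> 'a \<Rightarrow> real"
  assumes g2: "integrable M (\<lambda>x. (g x)\<^sup>2)" and ge: "\<And>k. integrable M (\<lambda>x. g x * e k x)"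
    and ee: "\<And>j k. integrable M (\<lambda>x. e j x * e k x)"
    and orth: "\<And>j k. (\<integral>x. e j x * e k x \<partial>M) = (if j = k then c else 0)" and c: "c > 0"
  shows "(\<lambda>k. \<integral>x. g x * e k x \<partial>M) \<longlonglongrightarrow> 0"
proof -
  define a where "a k = (\<integral>x. g x * e k x \<partial>M)" for k
  have bound: "(\<Sum>k<N. (a k)\<^sup>2) \<le> c * (\<integral>x. (g x)\<^sup>2 \<partial>M)" for N
  proof -
    have expand: "(c * g x - (\<Sum>k<N. a k * e k x))\<^sup>2 = c\<^sup>2 * (g x)\<^sup>2
        - 2 * c * (\<Sum>k<N. a k * (g x * e k x)) + (\<Sum>j<N. \<Sum>k<N. a j * a k * (e j x * e k x))" for x
    proof -
      have "(\<Sum>k<N. a k * (g x * e k x)) = g x * (\<Sum>k<N. a k * e k x)"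
        by (simp add: sum_distrib_left mult_ac)
      moreover have "(\<Sum>j<N. \<Sum>k<N. a j * a k * (e j x * e k x)) = (\<Sum>k<N. a k * e k x)\<^sup>2"
        by (simp add: power2_eq_square sum_product mult_ac)
      ultimately show ?thesis by (simp add: power2_eq_square algebra_simps)
    qed
    have "0 \<le> (\<integral>x. (c * g x - (\<Sum>k<N. a k * e k x))\<^sup>2 \<partial>M)" by simp
    also have "\<dots> = c\<^sup>2 * (\<integral>x. (g x)\<^sup>2 \<partial>M) - 2 * c * (\<Sum>k<N. a k * a k) 
        + (\<Sum>j<N. \<Sum>k<N. a j * a k * (if j = k then c else 0))"
      unfolding expand using g2 ge ee by (simp add: orth a_def)
    also have "(\<Sum>j<N. \<Sum>k<N. a j * a k * (if j = k then c else 0)) = c * (\<Sum>k<N. a k * a k)"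
      by (simp add: if_distrib sum.delta sum_distrib_left mult_ac cong: if_cong)
    finally have "c * (\<Sum>k<N. (a k)\<^sup>2) \<le> c * (c * (\<integral>x. (g x)\<^sup>2 \<partial>M))"
      by (simp add: power2_eq_square algebra_simps)
    thus ?thesis using c by simp
  qed
  have "summable (\<lambda>k. (a k)\<^sup>2)"
    by (rule summableI_nonneg_bounded[OF _ bound]) auto
  hence "(\<lambda>k. (a k)\<^sup>2) \<longlonglongrightarrow> 0" by (rule summable_LIMSEQ_zero)
  hence "(\<lambda>k. sqrt ((a k)\<^sup>2)) \<longlonglongrightarrow> sqrt 0" by (rule tendsto_real_sqrt)
  hence "a \<longlonglongrightarrow> 0" by (simp add: tendsto_rabs_zero_iff)
  thus ?thesis by (simp add: a_def[abs_def])
qed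

text \<open>
  Half-open, so that the integer translates partition the line exactly.
\<close>
abbreviation period :: "real set" where "period \<equiv> {-1/2<..1/2}"

lemma integral_cos_period:
  "has_bochner_integral lborel (\<lambda>x. indicator period x * cos (2 * pi * of_int n * x)) (if n = 0 then 1 else 0)"
proof -
  have "has_bochner_integral lborel (\<lambda>x. cos (2 * pi * of_int n * x) * indicator {-1/2..1/2} x) (if n = 0 then 1 else 0)"
  proof (cases "n = 0")
    case True
    have "has_bochner_integral lborel (\<lambda>x. 1 * indicator {-1/2..1/2::real} x) ((1/2) - (-1/2::real))"
      by (rule has_bochner_integral_FTC_Icc_real) auto
    thus ?thesis using True by simp
  next
    case False
    have "has_bochner_integral lborel (\<lambda>x. cos (2 * pi * of_int n * x) * indicator {-1/2..1/2} x)
        (sin (2 * pi * of_int n * (1/2)) / (2 * pi * of_int n) - sin (2 * pi * of_int n * (-1/2)) / (2 * pi * of_int n))"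
      using False by (intro has_bochner_integral_FTC_Icc_real) (auto intro!: derivative_eq_intros)
    thus ?thesis using False by (simp add: sin_int_times_real mult.commute)
  qed
  also have "?this \<longleftrightarrow> has_bochner_integral lborel (\<lambda>x. indicator period x * cos (2 * pi * of_int n * x)) (if n = 0 then 1 else 0)"
    by (intro has_bochner_integral_cong_AE eventually_mono[OF AE_lborel_singleton[of "-1/2"]])
       (auto simp: indicator_def)
  finally show ?thesis .
qed

lemma odd_sines_orthogonal:
  "has_bochner_integral lborel (\<lambda>x. (indicator period x * sin (real (2 * j + 1) * pi * x)) * (indicator period x * sin (real (2 * k + 1) * pi * x)))
     (if j = k then 1/2 else 0)"
proof -
  have *: "sin a * sin b = (1/2) * (cos (a - b) - cos (a + b))" for a b :: real
    by (simp add: cos_add cos_diff)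
  have prod: "sin (real (2 * j + 1) * pi * x) * sin (real (2 * k + 1) * pi * x) =
      (1/2) * (cos (2 * pi * of_int (int j - int k) * x) - cos (2 * pi * of_int (int j + int k + 1) * x))" for x
    unfolding * by (intro arg_cong2[of _ _ _ _ "\<lambda>a b. (1/2) * (cos a - cos b)"]) (simp_all add: algebra_simps)
  have "has_bochner_integral lborel (\<lambda>x. (1/2) * (indicator period x * cos (2 * pi * of_int (int j - int k) * x)
      - indicator period x * cos (2 * pi * of_int (int j + int k + 1) * x)))
     ((1/2) * ((if int j - int k = 0 then 1 else 0) - (if int j + int k + 1 = 0 then 1 else 0)))"
    by (intro has_bochner_integral_mult_right has_bochner_integral_diff integral_cos_period)
  also have "(\<lambda>x. (1/2) * (indicator period x * cos (2 * pi * of_int (int j - int k) * x)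
      - indicator period x * cos (2 * pi * of_int (int j + int k + 1) * x))) = 
     (\<lambda>x. (indicator period x * sin (real (2 * j + 1) * pi * x)) * (indicator period x * sin (real (2 * k + 1) * pi * x)))"
  proof
    fix x show "(1/2) * (indicator period x * cos (2 * pi * of_int (int j - int k) * x)
      - indicator period x * cos (2 * pi * of_int (int j + int k + 1) * x)) = 
      (indicator period x * sin (real (2 * j + 1) * pi * x)) * (indicator period x * sin (real (2 * k + 1) * pi * x))"
      using prod[of x] by (cases "x \<in> period") simp_all
  qed
  finally show ?thesis by (cases "j = k") simp_all
qed

definition dirichlet :: "nat \<Rightarrow> real \<Rightarrow> real" where
  "dirichlet K x = 1 + 2 * (\<Sum>k<K. cos (2 * pi * real (Suc k) * x))"

text \<open>
  Multiplication by \<open>sin (\<pi> x)\<close> makes the sum of cosines telescope.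
\<close>
lemma dirichlet_times_sin: "dirichlet K x * sin (pi * x) = sin (real (2 * K + 1) * pi * x)"
proof (induction K)
  case (Suc K)
  have "2 * cos a * sin b = sin (a + b) - sin (a - b)" for a b :: real
    by (simp add: sin_add sin_diff)
  from this[of "2 * pi * real (Suc K) * x" "pi * x"]
  show ?case using Suc by (simp add: dirichlet_def algebra_simps)
qed (simp add: dirichlet_def)

lemma integral_dirichlet:
  "has_bochner_integral lborel (\<lambda>x. indicator period x * dirichlet K x) 1"
proof -
  have "has_bochner_integral lborel (\<lambda>x. indicator period x * cos (2 * pi * of_int 0 * x) +
     2 * (\<Sum>k<K. indicator period x * cos (2 * pi * of_int (int (Suc k)) * x))) 
     ((if (0::int) = 0 then 1 else 0) + 2 * (\<Sum>k<K. (if int (Suc k) = 0 then 1 else 0)))"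
    by (intro has_bochner_integral_add has_bochner_integral_mult_right has_bochner_integral_sum integral_cos_period)
  also have "(\<lambda>x. indicator period x * cos (2 * pi * of_int 0 * x) +
     2 * (\<Sum>k<K. indicator period x * cos (2 * pi * of_int (int (Suc k)) * x))) = (\<lambda>x. indicator period x * dirichlet K x)"
    by (auto simp: dirichlet_def fun_eq_iff indicator_def)
  finally show ?thesis by simp
qed

lemma dirichlet_periodic: "dirichlet K (x + real n) = dirichlet K x" "dirichlet K (x - real n) = dirichlet K x"
proof -
  have "cos (2 * pi * real (Suc k) * (x + real n)) = cos (2 * pi * real (Suc k) * x)"
    "cos (2 * pi * real (Suc k) * (x - real n)) = cos (2 * pi * real (Suc k) * x)" for k
  proof -
    have "cos (y + 2 * pi * of_int m) = cos y" for y m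
      using cos.plus_of_int[where 'a=real, of y m] by (simp add: mult_ac)
    from this[of "2 * pi * real (Suc k) * x" "int (Suc k * n)"] this[of "2 * pi * real (Suc k) * x" "- int (Suc k * n)"]
    show "cos (2 * pi * real (Suc k) * (x + real n)) = cos (2 * pi * real (Suc k) * x)"
      "cos (2 * pi * real (Suc k) * (x - real n)) = cos (2 * pi * real (Suc k) * x)" 
      by (simp_all add: algebra_simps)
  qed
  thus "dirichlet K (x + real n) = dirichlet K x" "dirichlet K (x - real n) = dirichlet K x"
    by (simp_all only: dirichlet_def)
qed

text \<open>
  A weak form of Jordan's inequality, from the cubic Taylor bound for the sine. It keeps difference quotients
  with denominator \<open>sin (\<pi> x)\<close> bounded on a period.
\<close>
lemma abs_sin_ge:
  assumes "\<bar>x\<bar> \<le> 1/2"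
  shows "\<bar>x\<bar> \<le> \<bar>sin (pi * x)\<bar>"
proof -
  define y where "y = pi * \<bar>x\<bar>"
  have y: "0 \<le> y" "y \<le> 2" using assms pi_less_4 unfolding y_def by (auto simp: mult.commute intro: order_trans[OF mult_right_mono[of pi 4]])
  have "y * y \<le> 2 * 2" using y by (intro mult_mono) auto
  hence "y * (y * y) \<le> y * 4" using y by (intro mult_left_mono) auto
  moreover have "\<bar>sin y - (\<Sum>m<3. sin_coeff m * y ^ m)\<bar> \<le> inverse (fact 3) * \<bar>y\<bar> ^ 3"
    by (rule Maclaurin_sin_bound)
  ultimately have "sin y \<ge> y / 3"
    using y by (simp add: numeral_eq_Suc sin_coeff_def fact_numeral abs_if split: if_splits)
  moreover have "y / 3 \<ge> \<bar>x\<bar>" using pi_gt3 mult_right_mono[of 3 pi "\<bar>x\<bar>"] by (simp add: y_def)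
  moreover have "\<bar>sin (pi * x)\<bar> \<ge> sin y" by (cases "x \<ge> 0") (auto simp: y_def)
  ultimately show ?thesis by linarith
qed

lemma integral_period_unfold:
  fixes g :: "real \<Rightarrow> real"
  assumes [simp]: "integrable lborel g"
  shows "(\<integral>x. indicator {- (real N + 1/2)<..real N + 1/2} x * g x \<partial>lborel)
     = (\<integral>x. indicator period x * (g x + (\<Sum>n<N. g (x + real (Suc n)) + g (x - real (Suc n)))) \<partial>lborel)"
proof -
  have int: "integrable lborel (\<lambda>x. indicator S x * g (x + t))" if "S \<in> sets borel" for t S
  proof -
    have "integrable lborel (\<lambda>x. g (x + t))"
      using lborel_integrable_real_affine[of g 1 t] by (simp add: add.commute)
    thus ?thesis using integrable_mult_indicator[of S lborel "\<lambda>x. g (x + t)"] that by simp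
  qed
  note int' = int[of _ 0, simplified] int[of _ "- t" for t, simplified]
  have shift: "(\<integral>x. indicator period (x - t) * g x \<partial>lborel) = (\<integral>x. indicator period x * g (x + t) \<partial>lborel)" for t
    using lborel_integral_real_affine[of 1 "\<lambda>x. indicator period (x - t) * g x" t] by (simp add: add.commute)
  have intp: "integrable lborel (\<lambda>x. indicator period (x - t) * g x)" for t
  proof -
    have "integrable lborel (\<lambda>x. indicator {t-1/2<..t+1/2} x * g x)" by (intro int') auto
    also have "(\<lambda>x. indicator {t-1/2<..t+1/2} x * g x) = (\<lambda>x. indicator period (x - t) * g x)"
      by (auto simp: indicator_def fun_eq_iff)
    finally show ?thesis .
  qed
  show ?thesis
  proof (induction N)
    case (Suc N)
    have "(\<integral>x. indicator {- (real (Suc N) + 1/2)<..real (Suc N) + 1/2} x * g x \<partial>lborel) =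
      (\<integral>x. indicator {- (real N + 1/2)<..real N + 1/2} x * g x + (indicator period (x - real (Suc N)) * g x
          + indicator period (x - (- real (Suc N))) * g x) \<partial>lborel)"
      by (intro Bochner_Integration.integral_cong) (auto simp: indicator_def)
    also have "\<dots> = (\<integral>x. indicator {- (real N + 1/2)<..real N + 1/2} x * g x \<partial>lborel) +
       ((\<integral>x. indicator period x * g (x + real (Suc N)) \<partial>lborel) + (\<integral>x. indicator period x * g (x - real (Suc N)) \<partial>lborel))"
      using shift[of "real (Suc N)"] shift[of "- real (Suc N)"] intp[of "real (Suc N)"] intp[of "- real (Suc N)"] int'
      by (simp del: of_nat_Suc)
    also have "\<dots> = (\<integral>x. indicator period x * (g x + (\<Sum>n<Suc N. g (x + real (Suc n)) + g (x - real (Suc n)))) \<partial>lborel)"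
      unfolding Suc.IH
      by (simp add: distrib_left sum_distrib_left int int' del: of_nat_Suc)
    finally show ?case .
  qed simp
qed

lemma integral_expanding_intervals:
  fixes g :: "real \<Rightarrow> real"
  assumes "integrable lborel g"
  shows "(\<lambda>N. \<integral>x. indicator {- (real N + 1/2)<..real N + 1/2} x * g x \<partial>lborel) \<longlonglongrightarrow> (\<integral>x. g x \<partial>lborel)"
proof (rule integral_dominated_convergence[where w = "\<lambda>x. \<bar>g x\<bar>"])
  show "AE x in lborel. (\<lambda>N. indicator {- (real N + 1/2)<..real N + 1/2} x * g x) \<longlonglongrightarrow> g x"
  proof (rule AE_I2)
    fix x :: real
    obtain N0 :: nat where "\<bar>x\<bar> < real N0" using reals_Archimedean2 by blast
    hence "eventually (\<lambda>N. indicator {- (real N + 1/2)<..real N + 1/2} x * g x = g x) sequentially"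
      by (intro eventually_sequentiallyI[of N0]) (auto simp: indicator_def)
    thus "(\<lambda>N. indicator {- (real N + 1/2)<..real N + 1/2} x * g x) \<longlonglongrightarrow> g x"
      by (rule tendsto_eventually)
  qed
qed (use assms in \<open>auto simp: indicator_def\<close>)

text \<open>
  By the mean value theorem: between \<open>n - 1/2\<close> and \<open>n + 1/2\<close> every point lies between \<open>n/2\<close> and \<open>2n\<close>,
  so the derivative is controlled by a Gaussian in \<open>n\<close> and the bound remains summable over \<open>n\<close>.
\<close>
lemma gauss_lipschitz:
  fixes n :: real
  assumes "\<bar>x\<bar> \<le> 1/2" "n \<ge> 1"
  shows "\<bar>exp (- pi * (n + x)\<^sup>2 * v\<^sup>2) - exp (- pi * n\<^sup>2 * v\<^sup>2)\<bar> 
           \<le> 4 * pi * v\<^sup>2 * (n * exp (- (pi * v\<^sup>2 / 4) * n\<^sup>2)) * \<bar>x\<bar>"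
proof -
  let ?f = "\<lambda>y. exp (- pi * y\<^sup>2 * v\<^sup>2)"
  have "norm (?f (n + x) - ?f n) \<le> 4 * pi * v\<^sup>2 * (n * exp (- (pi * v\<^sup>2 / 4) * n\<^sup>2)) * norm ((n + x) - n)"
  proof (rule field_differentiable_bound[of "{n-1/2..n+1/2}"])
    fix y assume y: "y \<in> {n-1/2..n+1/2}"
    show "(?f has_field_derivative (exp (- pi * y\<^sup>2 * v\<^sup>2) * (- pi * (2 * y) * v\<^sup>2))) (at y within {n-1/2..n+1/2})"
      by (auto intro!: derivative_eq_intros)
    have y': "n / 2 \<le> y" "y \<le> 2 * n" using y assms by auto
    have "(n / 2)\<^sup>2 \<le> y\<^sup>2" using y' assms by (intro power_mono) auto
    hence "pi * v\<^sup>2 * (n / 2)\<^sup>2 \<le> pi * v\<^sup>2 * y\<^sup>2" by (intro mult_left_mono) auto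
    hence e: "exp (- pi * y\<^sup>2 * v\<^sup>2) \<le> exp (- (pi * v\<^sup>2 / 4) * n\<^sup>2)" by (simp add: power_divide mult_ac)
    have "norm (exp (- pi * y\<^sup>2 * v\<^sup>2) * (- pi * (2 * y) * v\<^sup>2)) = exp (- pi * y\<^sup>2 * v\<^sup>2) * (2 * pi * v\<^sup>2) * y"
      using y' assms by (simp add: abs_mult)
    also have "\<dots> \<le> exp (- (pi * v\<^sup>2 / 4) * n\<^sup>2) * (2 * pi * v\<^sup>2) * (2 * n)"
      using e y' assms by (intro mult_mono) auto
    finally show "norm (exp (- pi * y\<^sup>2 * v\<^sup>2) * (- pi * (2 * y) * v\<^sup>2)) \<le> 4 * pi * v\<^sup>2 * (n * exp (- (pi * v\<^sup>2 / 4) * n\<^sup>2))"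
      by (simp add: mult_ac)
  qed (use assms in auto)
  thus ?thesis by simp
qed

lemma gauss_lipschitz_0:
  assumes "\<bar>x\<bar> \<le> 1/2"
  shows "\<bar>exp (- pi * x\<^sup>2 * v\<^sup>2) - 1\<bar> \<le> pi * v\<^sup>2 * \<bar>x\<bar>"
proof -
  have eq: "- pi * x\<^sup>2 * v\<^sup>2 = - (pi * v\<^sup>2 * x\<^sup>2)" by simp
  have "exp (- (pi * v\<^sup>2 * x\<^sup>2)) \<ge> 1 + - (pi * v\<^sup>2 * x\<^sup>2)" by (rule exp_ge_add_one_self)
  moreover have "exp (- (pi * v\<^sup>2 * x\<^sup>2)) \<le> 1" by simp
  moreover have "x\<^sup>2 \<le> \<bar>x\<bar>" using mult_left_mono[of "\<bar>x\<bar>" 1 "\<bar>x\<bar>"] assms by (simp add: power2_eq_square)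
  hence "pi * v\<^sup>2 * x\<^sup>2 \<le> pi * v\<^sup>2 * \<bar>x\<bar>" by (intro mult_left_mono) auto
  ultimately show ?thesis unfolding eq by linarith
qed

lemma summable_gauss_sum:
  assumes "v \<noteq> 0"
  shows "summable (\<lambda>n. exp (- pi * (real (Suc n))\<^sup>2 * v\<^sup>2))"
  using summable_gauss[of "pi * v\<^sup>2"] assms by (simp add: mult_ac)

text \<open>
  Poisson summation for the Gaussian \<open>f\<close>, at the origin. The integral of \<open>f\<close> against the Dirichlet kernel \<open>D\<^sub>K\<close> over
  the line is a partial sum of \<open>\<Sum> f^(k)\<close>, the values of the Fourier transform. As \<open>D\<^sub>K\<close> is periodic with mean 1, it is
  also the integral of \<open>F D\<^sub>K\<close> over one period, where \<open>F\<close> is the sum of the integer translates of \<open>f\<close>, and hence differs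
  from \<open>F(0) = \<Sum> f(n)\<close> by the integral of \<open>(F - F(0)) D\<^sub>K = G sin ((2K+1) \<pi> x)\<close>, with \<open>G = (F - F(0)) / sin (\<pi> x)\<close>. The
  function \<open>G\<close> is bounded because \<open>F\<close> is Lipschitz at 0, so these integrals tend to 0 by Bessel's inequality.
\<close>
theorem gauss_sum_reciprocity:
  assumes v: "v > 0"
  shows "1 + 2 * gauss_sum (1 / v) = v * (1 + 2 * gauss_sum v)"
proof -
  define f where "f x = exp (- pi * x\<^sup>2 * v\<^sup>2)" for x :: real
  have f_even: "f (- x) = f x" "f 0 = 1" for x by (simp_all add: f_def)
  have f_int: "integrable lborel f" using gaussian_fourier(1)[OF v] by (simp add: f_def[abs_def])
  have [measurable]: "f \<in> borel_measurable borel" by (simp add: f_def[abs_def])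
  have [measurable]: "dirichlet K \<in> borel_measurable borel" for K by (simp add: dirichlet_def[abs_def])

  define s where "s K x = indicator period x * sin (real (2 * K + 1) * pi * x)" for K :: nat and x :: real
  have [measurable]: "s K \<in> borel_measurable borel" for K by (simp add: s_def[abs_def])
  have s_le: "\<bar>s K x\<bar> \<le> indicator period x" for K x by (auto simp: s_def indicator_def)

  \<comment> \<open>The \<open>n\<close>-th contribution to \<open>F(x) - F(0)\<close>, with the translates by \<open>n\<close> and \<open>- n\<close> taken together.\<close>
  define q where "q n x = (case n of 0 \<Rightarrow> f x - 1
      | Suc k \<Rightarrow> (f (x + real (Suc k)) - f (real (Suc k))) + (f (x - real (Suc k)) - f (real (Suc k))))" for n and x :: real
  have [measurable]: "q n \<in> borel_measurable borel" for n by (cases n) (simp_all add: q_def[abs_def])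
  define L where "L n = (case n of 0 \<Rightarrow> pi * v\<^sup>2 | Suc k \<Rightarrow> 
      2 * (4 * pi * v\<^sup>2 * (real (Suc k) * exp (- (pi * v\<^sup>2 / 4) * (real (Suc k))\<^sup>2))))" for n
  have L_sum: "summable L"
  proof -
    have "summable (\<lambda>k. L (Suc k))" unfolding L_def nat.case
      using v by (intro summable_mult summable_gauss_linear) auto
    thus ?thesis by (subst (asm) summable_Suc_iff)
  qed
  have L_nonneg: "L n \<ge> 0" for n by (cases n) (auto simp: L_def)
  have q_le: "\<bar>q n x\<bar> \<le> L n * \<bar>x\<bar>" if "x \<in> period" for n x
  proof (cases n)
    case 0
    thus ?thesis using gauss_lipschitz_0[of x v] that by (auto simp: q_def L_def f_def)
  next
    case (Suc k)
    have x: "\<bar>x\<bar> \<le> 1/2" "\<bar>-x\<bar> \<le> 1/2" using that by auto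
    have "f (x - real (Suc k)) = f (real (Suc k) + (-x))" using f_even(1)[of "x - real (Suc k)"] by (simp add: algebra_simps)
    thus ?thesis using gauss_lipschitz[OF x(1), of "real (Suc k)" v] gauss_lipschitz[OF x(2), of "real (Suc k)" v]
      unfolding Suc q_def L_def nat.case f_def[symmetric]
      by (simp add: add.commute distrib_right del: of_nat_Suc)
  qed
  \<comment> \<open>At \<open>x = 0\<close> the value is 0, as division by zero gives 0; there both \<open>F(x) - F(0)\<close> and the sines vanish.\<close>
  define r where "r n x = indicator period x * (q n x / sin (pi * x))" for n and x :: real
  have [measurable]: "r n \<in> borel_measurable borel" for n by (simp add: r_def[abs_def])
  have r_le: "\<bar>r n x\<bar> \<le> L n * indicator period x" for n x
  proof (cases "x \<in> period \<and> x \<noteq> 0")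
    case True
    hence "\<bar>x\<bar> > 0" "\<bar>x\<bar> \<le> \<bar>sin (pi * x)\<bar>" using abs_sin_ge[of x] by auto
    moreover have "L n * \<bar>x\<bar> \<le> L n * \<bar>sin (pi * x)\<bar>"
      using calculation L_nonneg by (intro mult_left_mono) auto
    ultimately show ?thesis using q_le[of x n] True by (auto simp: r_def abs_divide divide_le_eq)
  qed (auto simp: r_def L_nonneg)
  have r_le': "norm (r n x) \<le> L n" for n x
    using r_le[of n x] L_nonneg[of n] by (cases "x \<in> period") auto
  have r_sum: "summable (\<lambda>n. r n x)" for x
    by (rule summable_comparison_test'[OF L_sum, of 0]) (rule r_le')
  define GN where "GN N x = (\<Sum>n<N. r n x)" for N x
  define G where "G x = (\<Sum>n. r n x)" for x
  have [measurable]: "G \<in> borel_measurable borel" "GN N \<in> borel_measurable borel" for N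
    by (simp_all add: G_def[abs_def] GN_def[abs_def])
  define C where "C = suminf L"
  have C: "C \<ge> 0" unfolding C_def by (intro suminf_nonneg L_sum L_nonneg)
  have GN_le: "\<bar>GN N x\<bar> \<le> C * indicator period x" for N x
  proof -
    have "\<bar>GN N x\<bar> \<le> (\<Sum>n<N. L n * indicator period x)"
      unfolding GN_def by (rule order_trans[OF sum_abs]) (intro sum_mono r_le)
    also have "\<dots> = (\<Sum>n<N. L n) * indicator period x" by (simp add: sum_distrib_right)
    also have "\<dots> \<le> C * indicator period x" unfolding C_def
      by (intro mult_right_mono sum_le_suminf L_sum L_nonneg) auto
    finally show ?thesis .
  qed
  have GN_lim: "(\<lambda>N. GN N x) \<longlonglongrightarrow> G x" for x
    unfolding GN_def G_def by (rule summable_LIMSEQ[OF r_sum])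
  have G_le: "\<bar>G x\<bar> \<le> C * indicator period x" for x
    using GN_lim[of x] GN_le[of _ x] by (intro LIMSEQ_le_const2[OF tendsto_rabs]) auto

  have period_int: "integrable lborel (\<lambda>x. c * indicator period x :: real)" for c by simp
  have int_bounded: "integrable lborel g" if "g \<in> borel_measurable borel" "\<And>x. \<bar>g x\<bar> \<le> c * indicator period x" for g :: "real \<Rightarrow> real" and c
    by (rule Bochner_Integration.integrable_bound[OF period_int[of c]])
       (use that order_trans[OF that(2) abs_ge_self] in auto)

  have fD_int: "integrable lborel (\<lambda>x. f x * dirichlet K x)" for K
  proof (rule Bochner_Integration.integrable_bound[of _ "\<lambda>x. (1 + 2 * real K) * f x"])
    have "\<bar>dirichlet K x\<bar> \<le> 1 + 2 * real K" for x
    proof -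
      have "\<bar>\<Sum>k<K. cos (2 * pi * real (Suc k) * x)\<bar> \<le> (\<Sum>k<K. 1)"
        by (rule order_trans[OF sum_abs]) (intro sum_mono abs_cos_le_one)
      thus ?thesis unfolding dirichlet_def by simp
    qed
    thus "AE x in lborel. norm (f x * dirichlet K x) \<le> norm ((1 + 2 * real K) * f x)"
      by (intro AE_I2) (auto simp: abs_mult f_def)
  qed (use f_int in auto)
  define F0 where "F0 N = 1 + 2 * (\<Sum>n<N. f (real (Suc n)))" for N
  have finite_stage: "(\<integral>x. indicator {- (real N + 1/2)<..real N + 1/2} x * (f x * dirichlet K x) \<partial>lborel)
      = F0 N + (\<integral>x. GN (Suc N) x * s K x \<partial>lborel)" for N K
  proof -
    have pw: "indicator period x * (f x * dirichlet K x + (\<Sum>n<N. f (x + real (Suc n)) * dirichlet K (x + real (Suc n))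
             + f (x - real (Suc n)) * dirichlet K (x - real (Suc n)))) 
          = F0 N * (indicator period x * dirichlet K x) + GN (Suc N) x * s K x" for x
    proof (cases "x \<in> period")
      case True
      have q_sum: "(\<Sum>n<Suc N. q n x) = f x + (\<Sum>n<N. f (x + real (Suc n)) + f (x - real (Suc n))) - F0 N"
        unfolding sum.lessThan_Suc_shift q_def nat.case F0_def
        by (simp add: sum.distrib sum_subtractf sum_distrib_left del: of_nat_Suc)
      have "GN (Suc N) x * s K x = (\<Sum>n<Suc N. q n x) * dirichlet K x"
      proof (cases "x = 0")
        case True
        have "q n 0 = 0" for n 
          using f_even(1)[of "real n"] by (cases n) (auto simp: q_def f_even)
        thus ?thesis by (simp add: True s_def)
      next
        case False
        hence "\<bar>x\<bar> > 0" by simp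
        moreover have "\<bar>x\<bar> \<le> 1/2" using \<open>x \<in> period\<close> by auto
        ultimately have "\<bar>sin (pi * x)\<bar> > 0" using abs_sin_ge[of x] by linarith
        hence "sin (pi * x) \<noteq> 0" by auto
        thus ?thesis using \<open>x \<in> period\<close>
          unfolding GN_def r_def s_def dirichlet_times_sin[symmetric]
          by (simp add: sum_divide_distrib[symmetric] del: sum.lessThan_Suc)
      qed
      thus ?thesis using True unfolding q_sum dirichlet_periodic by (simp add: algebra_simps sum_distrib_left sum.distrib del: of_nat_Suc)
    qed (simp add: s_def)
    have "(\<integral>x. indicator {- (real N + 1/2)<..real N + 1/2} x * (f x * dirichlet K x) \<partial>lborel)
      = (\<integral>x. F0 N * (indicator period x * dirichlet K x) + GN (Suc N) x * s K x \<partial>lborel)"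
      unfolding integral_period_unfold[OF fD_int] pw ..
    also have "\<dots> = F0 N * (\<integral>x. indicator period x * dirichlet K x \<partial>lborel) + (\<integral>x. GN (Suc N) x * s K x \<partial>lborel)"
    proof (subst Bochner_Integration.integral_add)
      show "integrable lborel (\<lambda>x. GN (Suc N) x * s K x)"
      proof (rule int_bounded)
        show "\<bar>GN (Suc N) x * s K x\<bar> \<le> C * indicator period x" for x
          using mult_mono[OF GN_le[of "Suc N" x] s_le[of K x]] C by (auto simp: abs_mult indicator_def split: if_splits)
      qed simp
    qed (use integral_dirichlet[of K] in \<open>auto simp: has_bochner_integral_iff\<close>)
    also have "(\<integral>x. indicator period x * dirichlet K x \<partial>lborel) = 1"
      using integral_dirichlet[of K] by (simp add: has_bochner_integral_iff)
    finally show ?thesis by simp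
  qed
  have f_sums: "(\<lambda>n. f (real (Suc n))) sums gauss_sum v"
    unfolding f_def gauss_sum_def using v by (intro summable_sums summable_gauss_sum) auto
  have stage: "(\<integral>x. f x * dirichlet K x \<partial>lborel) = 1 + 2 * gauss_sum v + (\<integral>x. G x * s K x \<partial>lborel)" for K
  proof (rule LIMSEQ_unique)
    show "(\<lambda>N. \<integral>x. indicator {- (real N + 1/2)<..real N + 1/2} x * (f x * dirichlet K x) \<partial>lborel) \<longlonglongrightarrow> (\<integral>x. f x * dirichlet K x \<partial>lborel)"
      by (rule integral_expanding_intervals[OF fD_int])
    have "(\<lambda>N. \<integral>x. GN N x * s K x \<partial>lborel) \<longlonglongrightarrow> (\<integral>x. G x * s K x \<partial>lborel)"
    proof (rule integral_dominated_convergence[where w = "\<lambda>x. C * indicator period x"])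
      show "AE x in lborel. norm (GN N x * s K x) \<le> C * indicator period x" for N
      proof (rule AE_I2)
        fix x show "norm (GN N x * s K x) \<le> C * indicator period x"
        using mult_mono[OF GN_le[of "N" x] s_le[of K x]] C by (auto simp: abs_mult indicator_def split: if_splits)
      qed
    qed (auto intro!: tendsto_mult GN_lim)
    hence "(\<lambda>N. \<integral>x. GN (Suc N) x * s K x \<partial>lborel) \<longlonglongrightarrow> (\<integral>x. G x * s K x \<partial>lborel)" by (rule LIMSEQ_Suc)
    moreover have "F0 \<longlonglongrightarrow> 1 + 2 * gauss_sum v" using f_sums unfolding F0_def sums_def
      by (intro tendsto_intros)
    ultimately show "(\<lambda>N. \<integral>x. indicator {- (real N + 1/2)<..real N + 1/2} x * (f x * dirichlet K x) \<partial>lborel)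
        \<longlonglongrightarrow> 1 + 2 * gauss_sum v + (\<integral>x. G x * s K x \<partial>lborel)"
      unfolding finite_stage by (intro tendsto_add)
  qed
  have "(\<lambda>K. \<integral>x. G x * s K x \<partial>lborel) \<longlonglongrightarrow> 0"
  proof (rule bessel_tendsto_0[where c = "1/2"])
    show "integrable lborel (\<lambda>x. (G x)\<^sup>2)"
    proof (rule int_bounded)
      show "\<bar>(G x)\<^sup>2\<bar> \<le> C\<^sup>2 * indicator period x" for x
        using G_le[of x] by (auto simp: indicator_def intro: abs_le_square_iff[THEN iffD1] simp: C)
    qed simp
    show "integrable lborel (\<lambda>x. G x * s K x)" for K
    proof (rule int_bounded)
      show "\<bar>G x * s K x\<bar> \<le> C * indicator period x" for x
        using mult_mono[OF G_le[of x] s_le[of K x]] C by (auto simp: abs_mult indicator_def split: if_splits)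
    qed simp
  qed (use odd_sines_orthogonal in \<open>auto simp: s_def has_bochner_integral_iff\<close>)
  hence "(\<lambda>K. \<integral>x. f x * dirichlet K x \<partial>lborel) \<longlonglongrightarrow> 1 + 2 * gauss_sum v + 0"
    unfolding stage by (intro tendsto_intros)
  moreover have "(\<lambda>K. \<integral>x. f x * dirichlet K x \<partial>lborel) \<longlonglongrightarrow> (1 + 2 * gauss_sum (1 / v)) / v"
  proof -
    have "(\<integral>x. f x * dirichlet K x \<partial>lborel) = (1 + 2 * (\<Sum>k<K. exp (- pi * (real (Suc k))\<^sup>2 * (1 / v)\<^sup>2))) / v" for K
    proof -
      have int: "integrable lborel (\<lambda>x. f x * cos (2 * pi * k * x))" for k
        by (rule Bochner_Integration.integrable_bound[OF f_int]) (auto simp: f_def abs_mult)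
      have "(\<integral>x. f x * dirichlet K x \<partial>lborel) = (\<integral>x. f x * cos (2 * pi * 0 * x) + 2 * (\<Sum>k<K. f x * cos (2 * pi * real (Suc k) * x)) \<partial>lborel)"
        by (simp add: dirichlet_def distrib_left sum_distrib_left mult_ac)
      also have "\<dots> = (\<integral>x. f x * cos (2 * pi * 0 * x) \<partial>lborel) + 2 * (\<Sum>k<K. (\<integral>x. f x * cos (2 * pi * real (Suc k) * x) \<partial>lborel))"
        using int[of 0] int[of "real (Suc k)" for k]
        by (simp only: Bochner_Integration.integral_add integrable_mult_right Bochner_Integration.integrable_sum
             integral_mult_right_zero Bochner_Integration.integral_sum)
      also have "\<dots> = (1 + 2 * (\<Sum>k<K. exp (- pi * (real (Suc k))\<^sup>2 * (1 / v)\<^sup>2))) / v"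
        unfolding f_def gaussian_fourier(2)[OF v]
        by (simp add: sum_divide_distrib[symmetric] add_divide_distrib power_divide del: of_nat_Suc)
      finally show ?thesis .
    qed
    moreover have "(\<lambda>n. exp (- pi * (real (Suc n))\<^sup>2 * (1 / v)\<^sup>2)) sums gauss_sum (1 / v)"
      unfolding gauss_sum_def using v by (intro summable_sums summable_gauss_sum) auto
    ultimately show ?thesis using v unfolding sums_def by (auto intro!: tendsto_intros)
  qed
  ultimately have "1 + 2 * gauss_sum v + 0 = (1 + 2 * gauss_sum (1 / v)) / v" by (rule LIMSEQ_unique)
  thus ?thesis using v by (simp add: field_simps)
qed

section \<open>Parametric integrals and substitution\<close>

lemma laplace_integrable:
  fixes f :: "real \<Rightarrow> complex"
  assumes [measurable]: "f \<in> borel_measurable borel"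
    and int: "integrable lborel (\<lambda>t. norm (f t) * exp (R * \<bar>t\<bar>))" and z: "\<bar>Re z\<bar> \<le> R"
  shows "integrable lborel (\<lambda>t. f t * exp (z * of_real t))"
proof (rule Bochner_Integration.integrable_bound[OF int])
  have "Re z * t \<le> R * \<bar>t\<bar>" for t
  proof -
    have "Re z * t \<le> \<bar>Re z\<bar> * \<bar>t\<bar>" by (metis abs_ge_self abs_mult)
    also have "\<dots> \<le> R * \<bar>t\<bar>" using z by (intro mult_right_mono) auto
    finally show ?thesis .
  qed
  thus "AE t in lborel. norm (f t * exp (z * of_real t)) \<le> norm (norm (f t) * exp (R * \<bar>t\<bar>))"
    by (intro AE_I2) (auto simp: norm_mult intro!: mult_left_mono)
qed auto

text \<open>
  A factor \<open>t\<close> costs an arbitrarily small amount of exponential decay.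
\<close>
lemma laplace_integrable_linear:
  fixes f :: "real \<Rightarrow> complex"
  assumes [measurable]: "f \<in> borel_measurable borel"
    and int: "integrable lborel (\<lambda>t. norm (f t) * exp (R * \<bar>t\<bar>))" and r: "r < R"
  shows "integrable lborel (\<lambda>t. norm (of_real t * f t) * exp (r * \<bar>t\<bar>))"
proof (rule Bochner_Integration.integrable_bound)
  show "integrable lborel (\<lambda>t. 1 / (R - r) * (norm (f t) * exp (R * \<bar>t\<bar>)))" using int by simp
  have "\<bar>t\<bar> * exp (r * \<bar>t\<bar>) \<le> 1 / (R - r) * exp (R * \<bar>t\<bar>)" for t
  proof -
    have "(R - r) * \<bar>t\<bar> \<le> exp ((R - r) * \<bar>t\<bar>)" using exp_ge_add_one_self[of "(R - r) * \<bar>t\<bar>"] by linarith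
    hence "(R - r) * \<bar>t\<bar> * exp (r * \<bar>t\<bar>) \<le> exp ((R - r) * \<bar>t\<bar>) * exp (r * \<bar>t\<bar>)" by (intro mult_right_mono) auto
    also have "\<dots> = exp (R * \<bar>t\<bar>)" by (simp add: exp_add[symmetric] algebra_simps)
    finally show ?thesis using r by (simp add: field_simps)
  qed
  hence "norm (f t) * (\<bar>t\<bar> * exp (r * \<bar>t\<bar>)) \<le> norm (f t) * (1 / (R - r) * exp (R * \<bar>t\<bar>))" for t
    by (intro mult_left_mono) auto
  thus "AE t in lborel. norm (norm (of_real t * f t) * exp (r * \<bar>t\<bar>)) \<le> norm (1 / (R - r) * (norm (f t) * exp (R * \<bar>t\<bar>)))"
    using r by (intro AE_I2) (simp add: norm_mult abs_mult mult_ac)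
qed auto

text \<open>
  Differentiation under the integral sign. The difference quotients are dominated through
  \<open>\<bar>(exp (h t) - 1) / h\<bar> \<le> \<bar>t\<bar> exp (d \<bar>t\<bar>)\<close> for \<open>\<bar>h\<bar> \<le> d\<close>, where \<open>d\<close> is half of the distance of \<open>z\<close> to the
  boundary of the strip \<open>\<bar>Re z\<bar> < R\<close>: one half is spent on \<open>h\<close>, the other on the factor \<open>t\<close>.
\<close>
lemma laplace_has_derivative:
  fixes f :: "real \<Rightarrow> complex"
  assumes [measurable]: "f \<in> borel_measurable borel"
    and int: "integrable lborel (\<lambda>t. norm (f t) * exp (R * \<bar>t\<bar>))" and z: "\<bar>Re z\<bar> < R"
  shows "((\<lambda>z. \<integral>t. f t * exp (z * of_real t) \<partial>lborel) has_field_derivative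
     (\<integral>t. (of_real t * f t) * exp (z * of_real t) \<partial>lborel)) (at z)"
proof -
  define F where "F z = (\<integral>t. f t * exp (z * of_real t) \<partial>lborel)" for z
  define d where "d = (R - \<bar>Re z\<bar>) / 2"
  have d: "d > 0" "R - d < R" "\<bar>Re z\<bar> + d \<le> R - d" using z by (auto simp: d_def field_simps)
  have w_int: "integrable lborel (\<lambda>t. norm (of_real t * f t) * exp ((R - d) * \<bar>t\<bar>))"
    by (rule laplace_integrable_linear[OF _ int d(2)]) simp
  have step: "(\<lambda>n. (F (z + X n) - F z) / X n) \<longlonglongrightarrow> (\<integral>t. (of_real t * f t) * exp (z * of_real t) \<partial>lborel)"
    if X: "\<And>n. X n \<noteq> 0" "\<And>n. norm (X n) \<le> d" "X \<longlonglongrightarrow> 0" for X :: "nat \<Rightarrow> complex"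
  proof -
    have quot: "(F (z + X n) - F z) / X n = (\<integral>t. f t * exp (z * of_real t) * ((exp (X n * of_real t) - 1) / X n) \<partial>lborel)" for n
    proof -
      have "\<bar>Re (z + X n)\<bar> \<le> R" using abs_Re_le_cmod[of "X n"] X(2)[of n] d by (simp add: abs_if split: if_splits)
      hence i: "integrable lborel (\<lambda>t. f t * exp ((z + X n) * of_real t))" by (intro laplace_integrable[OF _ int]) auto
      have j: "integrable lborel (\<lambda>t. f t * exp (z * of_real t))" using z by (intro laplace_integrable[OF _ int]) auto
      have "(F (z + X n) - F z) / X n = (\<integral>t. (f t * exp ((z + X n) * of_real t) - f t * exp (z * of_real t)) / X n \<partial>lborel)"
        unfolding F_def using i j by simp
      also have "\<dots> = (\<integral>t. f t * exp (z * of_real t) * ((exp (X n * of_real t) - 1) / X n) \<partial>lborel)"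
        by (intro Bochner_Integration.integral_cong) (auto simp: distrib_right exp_add right_diff_distrib)
      finally show ?thesis .
    qed
    show ?thesis unfolding quot
    proof (rule integral_dominated_convergence[OF _ _ w_int])
      show "AE t in lborel. (\<lambda>n. f t * exp (z * of_real t) * ((exp (X n * of_real t) - 1) / X n)) \<longlonglongrightarrow> of_real t * f t * exp (z * of_real t)"
      proof (rule AE_I2)
        fix t :: real
        have "((\<lambda>w. exp (w * of_real t)) has_field_derivative of_real t) (at (0::complex))"
          by (auto intro!: derivative_eq_intros)
        hence "((\<lambda>h. (exp (h * of_real t) - 1) / h) \<longlongrightarrow> of_real t) (at (0::complex))"
          by (simp add: DERIV_def)
        hence "(\<lambda>n. (exp (X n * of_real t) - 1) / X n) \<longlonglongrightarrow> of_real t"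
          using X unfolding tendsto_at_iff_sequentially by (auto simp: o_def)
        hence "(\<lambda>n. f t * exp (z * of_real t) * ((exp (X n * of_real t) - 1) / X n)) \<longlonglongrightarrow> f t * exp (z * of_real t) * of_real t"
          by (intro tendsto_intros)
        thus "(\<lambda>n. f t * exp (z * of_real t) * ((exp (X n * of_real t) - 1) / X n)) \<longlonglongrightarrow> of_real t * f t * exp (z * of_real t)"
          by (simp add: mult_ac)
      qed
      show "AE t in lborel. norm (f t * exp (z * of_real t) * ((exp (X n * of_real t) - 1) / X n)) \<le> norm (of_real t * f t) * exp ((R - d) * \<bar>t\<bar>)" for n
      proof (rule AE_I2)
        fix t :: real
        have e1: "\<bar>Re (X n * of_real t)\<bar> \<le> d * \<bar>t\<bar>"
          using abs_Re_le_cmod[of "X n"] X(2)[of n] by (auto simp: abs_mult intro!: mult_right_mono)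
        have "norm (exp (X n * of_real t) - 1) \<le> exp \<bar>Re (X n * of_real t)\<bar> * norm (X n * of_real t)"
          using Taylor_exp[of "X n * of_real t" 0] by simp
        also have "\<dots> \<le> exp (d * \<bar>t\<bar>) * norm (X n * of_real t)" using e1 by (intro mult_right_mono) auto
        finally have q: "norm ((exp (X n * of_real t) - 1) / X n) \<le> exp (d * \<bar>t\<bar>) * \<bar>t\<bar>"
          using X(1)[of n] by (simp add: norm_divide norm_mult divide_le_eq mult_ac)
        have "Re z * t \<le> \<bar>Re z\<bar> * \<bar>t\<bar>" by (metis abs_ge_self abs_mult)
        hence p: "norm (exp (z * of_real t)) \<le> exp (\<bar>Re z\<bar> * \<bar>t\<bar>)" by simp
        have "norm (f t * exp (z * of_real t) * ((exp (X n * of_real t) - 1) / X n)) \<le>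
            norm (f t) * exp (\<bar>Re z\<bar> * \<bar>t\<bar>) * (exp (d * \<bar>t\<bar>) * \<bar>t\<bar>)"
          unfolding norm_mult by (intro mult_mono p q) auto
        also have "\<dots> = norm (of_real t * f t) * exp ((\<bar>Re z\<bar> + d) * \<bar>t\<bar>)"
          unfolding distrib_right exp_add by (simp add: norm_mult mult_ac)
        also have "\<dots> \<le> norm (of_real t * f t) * exp ((R - d) * \<bar>t\<bar>)"
          using d(3) by (intro mult_left_mono) (auto intro!: mult_right_mono)
        finally show "norm (f t * exp (z * of_real t) * ((exp (X n * of_real t) - 1) / X n)) \<le> norm (of_real t * f t) * exp ((R - d) * \<bar>t\<bar>)" .
      qed
    qed auto
  qed
  have "((\<lambda>h. (F (z + h) - F z) / h) \<longlongrightarrow> (\<integral>t. (of_real t * f t) * exp (z * of_real t) \<partial>lborel)) (at 0)"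
    unfolding tendsto_at_iff_sequentially
  proof (intro allI impI)
    fix X :: "nat \<Rightarrow> complex" assume X: "\<forall>i. X i \<in> UNIV - {0}" "X \<longlonglongrightarrow> 0"
    have "eventually (\<lambda>n. norm (X n) < d) sequentially"
      using tendstoD[OF X(2) d(1)] by simp
    then obtain n0 where n0: "\<And>n. n \<ge> n0 \<Longrightarrow> norm (X n) < d" by (auto simp: eventually_sequentially)
    have "(\<lambda>n. (F (z + X (n + n0)) - F z) / X (n + n0)) \<longlonglongrightarrow> (\<integral>t. (of_real t * f t) * exp (z * of_real t) \<partial>lborel)"
      using X n0 by (intro step LIMSEQ_ignore_initial_segment[OF X(2)]) (auto intro: less_imp_le)
    hence "(\<lambda>n. (F (z + X n) - F z) / X n) \<longlonglongrightarrow> (\<integral>t. (of_real t * f t) * exp (z * of_real t) \<partial>lborel)"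
      by (rule LIMSEQ_offset)
    thus "((\<lambda>h. (F (z + h) - F z) / h) \<circ> X) \<longlonglongrightarrow> (\<integral>t. (of_real t * f t) * exp (z * of_real t) \<partial>lborel)"
      by (simp add: o_def)
  qed
  thus ?thesis unfolding F_def DERIV_def .
qed

text \<open>
  The change of variables for absolutely integrable functions, transferred from the completed measure to
  Lebesgue--Borel measure.
\<close>
lemma lborel_integral_substitution_UNIV:
  fixes f :: "real \<Rightarrow> 'a :: euclidean_space" and g h :: "real \<Rightarrow> real"
  assumes deriv: "\<And>x. (g has_field_derivative h x) (at x)" and inj: "inj g" and pos: "\<And>x. h x > 0"
    and [measurable]: "f \<in> borel_measurable borel" "g \<in> borel_measurable borel" "h \<in> borel_measurable borel" "range g \<in> sets borel"
  shows "set_integrable lborel (range g) f \<longleftrightarrow> integrable lborel (\<lambda>x. h x *\<^sub>R f (g x))"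
    and "(LINT y:range g|lborel. f y) = (\<integral>x. h x *\<^sub>R f (g x) \<partial>lborel)"
proof -
  have L: "set_integrable lebesgue (range g) f \<longleftrightarrow> set_integrable lborel (range g) f"
    unfolding set_integrable_def by (rule integrable_completion) measurable
  have R: "set_integrable lebesgue UNIV (\<lambda>x. h x *\<^sub>R f (g x)) \<longleftrightarrow> integrable lborel (\<lambda>x. h x *\<^sub>R f (g x))"
    unfolding set_integrable_def by (simp, rule integrable_completion) measurable
  have *: "((\<lambda>x. h x *\<^sub>R f (g x)) absolutely_integrable_on UNIV \<and> integral UNIV (\<lambda>x. h x *\<^sub>R f (g x)) = b) \<longleftrightarrow>
      (f absolutely_integrable_on range g \<and> integral (range g) f = b)" for b
    using has_absolute_integral_change_of_variables_real[of UNIV g h f b] deriv inj pos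
    by (simp add: abs_of_pos)
  from * show iff: "set_integrable lborel (range g) f \<longleftrightarrow> integrable lborel (\<lambda>x. h x *\<^sub>R f (g x))"
    unfolding L[symmetric] R[symmetric] by blast
  show "(LINT y:range g|lborel. f y) = (\<integral>x. h x *\<^sub>R f (g x) \<partial>lborel)"
  proof (cases "set_integrable lborel (range g) f")
    case True
    hence T: "set_integrable lebesgue (range g) f" "set_integrable lebesgue UNIV (\<lambda>x. h x *\<^sub>R f (g x))"
      using L R iff by auto
    have "(LINT y:range g|lborel. f y) = (LINT y:range g|lebesgue. f y)"
      unfolding set_lebesgue_integral_def by (rule integral_completion[symmetric]) measurable
    also have "\<dots> = integral (range g) f" using T(1) by (rule set_lebesgue_integral_eq_integral(2))
    also have "\<dots> = integral UNIV (\<lambda>x. h x *\<^sub>R f (g x))" using * T by blast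
    also have "\<dots> = (LINT x:UNIV|lebesgue. h x *\<^sub>R f (g x))" using T(2) by (rule set_lebesgue_integral_eq_integral(2)[symmetric])
    also have "\<dots> = (\<integral>x. h x *\<^sub>R f (g x) \<partial>lborel)"
      unfolding set_lebesgue_integral_def by (simp, rule integral_completion) measurable
    finally show ?thesis .
  next
    case False
    with iff show ?thesis
      by (simp add: not_integrable_integral_eq set_lebesgue_integral_def set_integrable_def)
  qed
qed

section \<open>The Fourier transform of the hyperbolic secant\<close>

lemma borel_measurable_cosh [measurable]:
  assumes [measurable]: "f \<in> borel_measurable M"
  shows "(\<lambda>x. cosh (f x :: real)) \<in> borel_measurable M"
  unfolding cosh_def by measurable

text \<open>
  The substitution \<open>r = 1 / (1 + exp (- 2 \<pi> t))\<close> turns the Beta integral of \<open>a\<close> and \<open>1 - a\<close>, with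
  \<open>a = 1/2 + z / (2\<pi>)\<close>, into this one; the reflection formula evaluates it.
\<close>
lemma integral_exp_sech_real:
  fixes z :: real
  assumes z: "\<bar>z\<bar> < pi"
  shows "has_bochner_integral lborel (\<lambda>t. exp (z * t) / cosh (pi * t)) (1 / cos (z / 2))"
proof -
  define a where "a = 1/2 + z / (2 * pi)"
  have a: "0 < a" "a < 1" using z pi_gt_zero by (auto simp: a_def field_simps abs_less_iff)
  define g :: "real \<Rightarrow> real" where "g t = 1 / (1 + exp (- (2 * pi * t)))" for t
  define h :: "real \<Rightarrow> real" where "h t = 2 * pi * exp (- (2 * pi * t)) / (1 + exp (- (2 * pi * t)))\<^sup>2" for t
  define f where "f r = r powr (a - 1) * (1 - r) powr ((1 - a) - 1)" for r :: real
  have pos: "1 + exp u > 0" for u :: real by (simp add: add_pos_pos)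
  have nz: "1 + exp u \<noteq> 0" for u :: real using pos[of u] by simp
  have deriv: "(g has_field_derivative h t) (at t)" for t
    unfolding g_def h_def using nz by (auto intro!: derivative_eq_intros simp: power2_eq_square)
  have inj: "inj g" unfolding g_def inj_def using nz by (auto simp: field_simps)
  have h_pos: "h t > 0" for t unfolding h_def by (intro divide_pos_pos mult_pos_pos zero_less_power pos) auto
  have range: "range g = {0<..<1}"
  proof safe
    fix t show "g t \<in> {0<..<1}" using pos[of "- (2 * pi * t)"] by (auto simp: g_def field_simps)
  next
    fix r :: real assume r: "r \<in> {0<..<1}"
    have "r = g (ln (r / (1 - r)) / (2 * pi))"
      using r by (simp add: g_def exp_minus field_simps)
    thus "r \<in> range g" by blast
  qed
  have meas [measurable]: "f \<in> borel_measurable borel" "g \<in> borel_measurable borel" "h \<in> borel_measurable borel"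
    by (simp_all add: f_def[abs_def] g_def[abs_def] h_def[abs_def])
  have val: "h t *\<^sub>R f (g t) = pi * (exp (z * t) / cosh (pi * t))" for t
  proof -
    let ?e = "exp (- (2 * pi * t))"
    have 1: "1 - g t = ?e / (1 + ?e)" using nz[of "- (2 * pi * t)"] by (simp add: g_def field_simps)
    have E: "1 + ?e > 0" by (rule pos)
    have "f (g t) = (1 / (1 + ?e)) powr (a - 1) * (?e / (1 + ?e)) powr (- a)"
      unfolding f_def 1 unfolding g_def by simp
    also have "\<dots> = exp ((a - 1) * (0 - ln (1 + ?e))) * exp ((- a) * (- (2 * pi * t) - ln (1 + ?e)))"
      using E by (simp add: powr_def ln_div)
    also have "\<dots> = exp (2 * pi * t * a + ln (1 + ?e))"
      unfolding exp_add[symmetric] by (simp add: algebra_simps)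
    also have "\<dots> = exp (2 * pi * t * a) * (1 + ?e)"
      unfolding exp_add using E by simp
    finally have "h t * f (g t) = 2 * pi * (?e * exp (2 * pi * t * a)) / (1 + ?e)"
      using nz[of "- (2 * pi * t)"] by (simp add: h_def power2_eq_square)
    also have "?e * exp (2 * pi * t * a) = exp (z * t) * exp (- (pi * t))"
      by (simp add: exp_add[symmetric] a_def field_simps)
    also have "1 + ?e = exp (- (pi * t)) * (exp (pi * t) + exp (- (pi * t)))"
      by (simp add: distrib_left exp_add[symmetric])
    finally show ?thesis by (simp add: cosh_def)
  qed
  have B: "set_integrable lborel {0..1} f" unfolding f_def using a by (intro integrable_Beta) auto
  have B1: "set_integrable lborel {0<..<1} f" by (rule set_integrable_subset[OF B]) auto
  have "(LINT r:{0<..<1}|lborel. f r) = integral {0<..<1} f" 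
    by (rule set_borel_integral_eq_integral(2)[OF B1])
  also have "\<dots> = Beta a (1 - a)"
    using has_integral_Beta_real[of a "1 - a"] a unfolding f_def by (simp add: has_integral_Icc_iff_Ioo integral_unique)
  also have "\<dots> = Gamma a * Gamma (1 - a)" by (simp add: Beta_def)
  also have "\<dots> = pi / sin (pi * a)"
  proof -
    have "complex_of_real (Gamma a * Gamma (1 - a)) = of_real (pi / sin (pi * a))"
    proof -
      have "complex_of_real (Gamma a * Gamma (1 - a)) = Gamma (of_real a) * Gamma (of_real (1 - a))"
        by (simp only: of_real_mult Gamma_complex_of_real)
      also have "\<dots> = of_real pi / sin (of_real pi * of_real a)"
        using Gamma_reflection_complex[of "of_real a"] by (simp only: of_real_diff of_real_1)
      also have "\<dots> = of_real (pi / sin (pi * a))"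
        by (simp only: of_real_divide sin_of_real[symmetric] of_real_mult)
      finally show ?thesis .
    qed
    thus ?thesis by (simp only: of_real_eq_iff)
  qed
  also have "sin (pi * a) = cos (z / 2)"
    by (simp add: a_def distrib_left sin_add)
  finally have I: "(LINT r:{0<..<1}|lborel. f r) = pi / cos (z / 2)" .
  have "has_bochner_integral lborel (\<lambda>t. h t *\<^sub>R f (g t)) (pi / cos (z / 2))"
    using lborel_integral_substitution_UNIV[of g h f, OF deriv inj h_pos] B1 I 
    unfolding range has_bochner_integral_iff by auto
  hence "has_bochner_integral lborel (\<lambda>t. (1 / pi) * (pi * (exp (z * t) / cosh (pi * t)))) ((1 / pi) * (pi / cos (z / 2)))"
    unfolding val by (rule has_bochner_integral_mult_right)
  thus ?thesis by simp
qed

lemma integrable_sech_exp_abs: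
  assumes "R < pi"
  shows "integrable lborel (\<lambda>t. norm (1 / of_real (cosh (pi * t)) :: complex) * exp (R * \<bar>t\<bar>))"
proof -
  define r where "r = max R 0"
  have r: "\<bar>r\<bar> < pi" "\<bar>-r\<bar> < pi" "R \<le> r" using assms pi_gt_zero by (auto simp: r_def)
  have "integrable lborel (\<lambda>t. exp (r * t) / cosh (pi * t) + exp (- r * t) / cosh (pi * t))"
    using integral_exp_sech_real[OF r(1)] integral_exp_sech_real[OF r(2)]
    by (intro Bochner_Integration.integrable_add) (auto simp: has_bochner_integral_iff)
  thus ?thesis
  proof (rule Bochner_Integration.integrable_bound)
    have "exp (R * \<bar>t\<bar>) \<le> exp (r * t) + exp (- r * t)" for t
    proof -
      have "R * \<bar>t\<bar> \<le> r * \<bar>t\<bar>" using r by (intro mult_right_mono) auto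
      hence "exp (R * \<bar>t\<bar>) \<le> exp (r * \<bar>t\<bar>)" by simp
      also have "\<dots> \<le> exp (r * t) + exp (- r * t)" by (cases "t \<ge> 0") auto
      finally show ?thesis .
    qed
    thus "AE t in lborel. norm (norm (1 / of_real (cosh (pi * t)) :: complex) * exp (R * \<bar>t\<bar>)) \<le>
       norm (exp (r * t) / cosh (pi * t) + exp (- r * t) / cosh (pi * t))"
      by (intro AE_I2) (auto simp: norm_divide add_divide_distrib[symmetric] intro!: divide_right_mono order_trans[OF _ abs_ge_self])
  qed auto
qed

text \<open>
  Both sides are holomorphic in the strip and agree on its real points.
\<close>
lemma integral_exp_sech:
  assumes z: "\<bar>Re z\<bar> < pi"
  shows "(\<integral>t. 1 / of_real (cosh (pi * t)) * exp (z * of_real t) \<partial>lborel) = 1 / cos (z / 2)"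
proof -
  define F where "F z = (\<integral>t. 1 / of_real (cosh (pi * t)) * exp (z * of_real t) \<partial>lborel)" for z :: complex
  define S where "S = {z :: complex. \<bar>Re z\<bar> < pi}"
  have S_eq: "S = {z. Re z < pi} \<inter> {z. Re z > - pi}" by (auto simp: S_def)
  have S: "open S" "connected S"
    unfolding S_eq by (auto intro!: open_Int open_halfspace_Re_lt open_halfspace_Re_gt convex_connected convex_Int
       convex_halfspace_Re_lt convex_halfspace_Re_gt)
  have "F holomorphic_on S"
  proof (rule holomorphic_onI)
    fix w assume "w \<in> S"
    then obtain R where R: "\<bar>Re w\<bar> < R" "R < pi" using dense unfolding S_def by blast
    have "(F has_field_derivative (\<integral>t. (of_real t * (1 / of_real (cosh (pi * t)))) * exp (w * of_real t) \<partial>lborel)) (at w)"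
      unfolding F_def by (rule laplace_has_derivative[OF _ integrable_sech_exp_abs[OF R(2)] R(1)]) measurable
    thus "F field_differentiable at w within S"
      by (meson field_differentiable_at_within field_differentiable_def)
  qed
  hence hol: "(\<lambda>w. F w * cos (w / 2) - 1) holomorphic_on S" by (intro holomorphic_intros) auto
  have real: "F (of_real x) * cos (of_real x / 2) - 1 = 0" if "\<bar>x\<bar> < pi" for x :: real
  proof -
    have "F (of_real x) = (\<integral>t. complex_of_real (exp (x * t) / cosh (pi * t)) \<partial>lborel)"
      unfolding F_def by (intro Bochner_Integration.integral_cong) (auto simp flip: exp_of_real)
    also have "\<dots> = of_real (1 / cos (x / 2))"
      unfolding integral_complex_of_real
      using integral_exp_sech_real[OF that] by (simp add: has_bochner_integral_iff)
    finally have "F (of_real x) = of_real (1 / cos (x / 2))" .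
    moreover have "cos (x / 2) \<noteq> 0" using cos_gt_zero_pi[of "x / 2"] that by (auto simp: abs_less_iff)
    moreover have "cos (complex_of_real x / 2) = of_real (cos (x / 2))" by (simp flip: cos_of_real)
    ultimately show ?thesis by simp
  qed
  \<comment> \<open>The real points of the strip accumulate at 0.\<close>
  have lim: "(0::complex) islimpt of_real ` {-pi<..<pi}"
    unfolding islimpt_approachable
  proof safe
    fix e :: real assume e: "e > 0"
    define x where "x = min (e / 2) 1"
    have "x > 0" "x < e" "x < pi" using e pi_gt3 by (auto simp: x_def)
    thus "\<exists>x'\<in>of_real ` {-pi<..<pi}. x' \<noteq> (0::complex) \<and> dist x' 0 < e"
      by (intro bexI[of _ "of_real x"] conjI imageI) auto
  qed
  have "F z * cos (z / 2) - 1 = 0"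
    by (rule analytic_continuation[OF hol S _ _ lim, of z])
       (use z real in \<open>auto simp: S_def\<close>)
  hence "F z * cos (z / 2) = 1" by simp
  moreover from this have "cos (z / 2) \<noteq> 0" by auto
  ultimately show ?thesis unfolding F_def by (simp add: eq_divide_eq)
qed


definition sech_poly :: "nat \<Rightarrow> real \<Rightarrow> complex" where
  "sech_poly m t = pochhammer (1/2 + \<i> * of_real t) m / of_real (cosh (pi * t))"

lemma sech_poly_Suc: "sech_poly (Suc m) t = (1/2 + of_nat m) * sech_poly m t + \<i> * (of_real t * sech_poly m t)"
  by (simp add: sech_poly_def pochhammer_Suc algebra_simps add_divide_distrib)

lemma sech_poly_measurable [measurable]: "sech_poly m \<in> borel_measurable borel"
proof (induction m)
  case 0 show ?case by (simp add: sech_poly_def[abs_def])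
next
  case (Suc m)
  note [measurable] = Suc
  show ?case unfolding sech_poly_Suc[abs_def] by measurable
qed

text \<open>
  The factor \<open>1 / cosh (\<pi> t)\<close> decays like \<open>exp (- \<pi> \<bar>t\<bar>)\<close>, and each further linear factor costs an arbitrarily
  small part of this decay.
\<close>
lemma integrable_sech_poly_exp_abs:
  assumes "R < pi"
  shows "integrable lborel (\<lambda>t. norm (sech_poly m t) * exp (R * \<bar>t\<bar>))"
  using assms
proof (induction m arbitrary: R)
  case 0
  thus ?case using integrable_sech_exp_abs[of R] by (simp add: sech_poly_def)
next
  case (Suc m)
  \<comment> \<open>the room that the new linear factor needs\<close>
  obtain R' where R': "R < R'" "R' < pi" using Suc.prems dense by blast
  have 1: "integrable lborel (\<lambda>t. norm (sech_poly m t) * exp (R * \<bar>t\<bar>))" by (rule Suc.IH) fact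
  have 2: "integrable lborel (\<lambda>t. norm (of_real t * sech_poly m t) * exp (R * \<bar>t\<bar>))"
    by (rule laplace_integrable_linear[OF _ Suc.IH[OF R'(2)] R'(1)]) simp
  show ?case
  proof (rule Bochner_Integration.integrable_bound)
    show "integrable lborel (\<lambda>t. (1/2 + real m) * (norm (sech_poly m t) * exp (R * \<bar>t\<bar>)) + norm (of_real t * sech_poly m t) * exp (R * \<bar>t\<bar>))"
      using 1 2 by simp
    have "norm (sech_poly (Suc m) t) \<le> (1/2 + real m) * norm (sech_poly m t) + norm (of_real t * sech_poly m t)" for t
    proof -
      have "norm (1/2 + of_nat m :: complex) = 1/2 + real m"
        using norm_of_real[of "1/2 + real m", where 'a=complex] by simp
      thus ?thesis unfolding sech_poly_Suc by (intro order_trans[OF norm_triangle_ineq]) (simp add: norm_mult)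
    qed
    hence "norm (sech_poly (Suc m) t) * exp (R * \<bar>t\<bar>) \<le> ((1/2 + real m) * norm (sech_poly m t) + norm (of_real t * sech_poly m t)) * exp (R * \<bar>t\<bar>)" for t
      by (intro mult_right_mono) auto
    thus "AE t in lborel. norm (norm (sech_poly (Suc m) t) * exp (R * \<bar>t\<bar>)) \<le>
       norm ((1/2 + real m) * (norm (sech_poly m t) * exp (R * \<bar>t\<bar>)) + norm (of_real t * sech_poly m t) * exp (R * \<bar>t\<bar>))"
      by (intro AE_I2) (simp add: algebra_simps)
  qed auto
qed

lemma integrable_sech_poly: "integrable lborel (sech_poly m)"
  using integrable_sech_poly_exp_abs[of 0 m] by (simp add: integrable_norm_iff)

text \<open>
  Passing from \<open>m\<close> to \<open>m + 1\<close> multiplies the integrand by \<open>1/2 + m + it\<close>, hence applies \<open>1/2 + m + d/dv\<close> to the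
  transform, and the closed form satisfies the same recursion. The case \<open>m = 0\<close> is the self-duality of the
  hyperbolic secant.
\<close>
theorem fourier_sech_poly:
  "(\<integral>t. sech_poly m t * exp (\<i> * of_real v * of_real t) \<partial>lborel) = of_real (2 * fact m * exp (v / 2) / (1 + exp v) ^ Suc m)"
proof (induction m arbitrary: v)
  case 0
  have "1 / cos (\<i> * of_real v / 2) = (1 / of_real (cosh (v / 2)) :: complex)"
  proof -
    have "cosh (complex_of_real (v / 2)) = of_real (cosh (v / 2))"
      unfolding cosh_field_def by (simp flip: exp_of_real add: exp_minus)
    thus ?thesis using cosh_conv_cos[of "of_real (v / 2) :: complex"] by simp
  qed
  also have "\<dots> = of_real (2 * exp (v / 2) / (1 + exp v))"
  proof -
    have "exp v = exp (v / 2) * exp (v / 2)" by (simp flip: exp_add)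
    thus ?thesis by (simp add: cosh_def exp_minus field_simps)
  qed
  finally show ?case using integral_exp_sech[of "\<i> * of_real v"] by (simp add: sech_poly_def)
next
  case (Suc m)
  define \<Phi> where "\<Phi> v = (\<integral>t. sech_poly m t * exp (\<i> * of_real v * of_real t) \<partial>lborel)" for v :: real
  define \<Psi> where "\<Psi> = (\<integral>t. (of_real t * sech_poly m t) * exp (\<i> * of_real v * of_real t) \<partial>lborel)"
  define E where "E = 1 + exp v"
  have E: "E > 0" by (simp add: E_def add_pos_pos)
  have "((\<lambda>z. \<integral>t. sech_poly m t * exp (z * of_real t) \<partial>lborel) has_field_derivative \<Psi>) (at (\<i> * of_real v))"
    unfolding \<Psi>_def by (rule laplace_has_derivative[OF _ integrable_sech_poly_exp_abs[of 1]]) (use pi_gt3 in auto)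
  note chain = field_vector_diff_chain_at[where f = "\<lambda>v. \<i> * of_real v" and f' = \<i>, OF _ this]
  have "(\<Phi> has_vector_derivative \<i> * \<Psi>) (at v)"
  proof -
    have "((\<lambda>v. \<i> * complex_of_real v) has_vector_derivative \<i> * of_real 1) (at v)"
      by (intro has_vector_derivative_mult_right has_vector_derivative_of_real DERIV_ident)
    thus ?thesis using chain unfolding \<Phi>_def o_def by simp
  qed
  moreover have "(\<Phi> has_vector_derivative of_real (2 * fact m * exp (v / 2) * (1/2 / E ^ Suc m - (1 + real m) * exp v / E ^ Suc (Suc m)))) (at v)"
  proof -
    have "((\<lambda>v. 2 * fact m * exp (v / 2) / (1 + exp v) ^ Suc m) has_field_derivative
       (2 * fact m * exp (v / 2) * (1/2 / E ^ Suc m - (1 + real m) * exp v / E ^ Suc (Suc m)))) (at v)"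
    proof -
      have "((\<lambda>v. 2 * fact m * exp (v / 2)) has_field_derivative fact m * exp (v / 2)) (at v)"
        by (auto intro!: derivative_eq_intros)
      moreover have "((\<lambda>v. (1 + exp v) ^ Suc m) has_field_derivative (1 + real m) * E ^ m * exp v) (at v)"
      proof -
        have "((\<lambda>v. 1 + exp v) has_field_derivative exp v) (at v)" by (auto intro!: derivative_eq_intros)
        from DERIV_power[OF this, of "Suc m"] show ?thesis by (simp add: E_def mult_ac)
      qed
      moreover have "(1 + exp v) ^ Suc m \<noteq> 0" using E by (simp add: E_def)
      ultimately have "((\<lambda>v. 2 * fact m * exp (v / 2) / (1 + exp v) ^ Suc m) has_field_derivative
         (fact m * exp (v / 2) * E ^ Suc m - 2 * fact m * exp (v / 2) * ((1 + real m) * E ^ m * exp v)) / (E ^ Suc m * E ^ Suc m)) (at v)"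
        unfolding E_def by (rule DERIV_divide)
      also have "(fact m * exp (v / 2) * E ^ Suc m - 2 * fact m * exp (v / 2) * ((1 + real m) * E ^ m * exp v)) / (E ^ Suc m * E ^ Suc m)
         = 2 * fact m * exp (v / 2) * (1/2 / E ^ Suc m - (1 + real m) * exp v / E ^ Suc (Suc m))"
        using E by (simp add: field_simps)
      finally show ?thesis .
    qed
    from has_vector_derivative_of_real[OF this] show ?thesis
      unfolding \<Phi>_def Suc.IH .
  qed
  ultimately have \<Psi>: "\<i> * \<Psi> = of_real (2 * fact m * exp (v / 2) * (1/2 / E ^ Suc m - (1 + real m) * exp v / E ^ Suc (Suc m)))"
    by (rule vector_derivative_unique_at)
  have i1: "integrable lborel (\<lambda>t. sech_poly m t * exp (\<i> * of_real v * of_real t))"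
    by (rule laplace_integrable[OF _ integrable_sech_poly_exp_abs[of 0]]) auto
  have i2: "integrable lborel (\<lambda>t. (of_real t * sech_poly m t) * exp (\<i> * of_real v * of_real t))"
  proof (rule laplace_integrable)
    show "integrable lborel (\<lambda>t. norm (of_real t * sech_poly m t) * exp (0 * \<bar>t\<bar>))"
      by (rule laplace_integrable_linear[OF _ integrable_sech_poly_exp_abs[of 1]]) (use pi_gt3 in auto)
  qed auto
  have "(\<integral>t. sech_poly (Suc m) t * exp (\<i> * of_real v * of_real t) \<partial>lborel) = 
     (\<integral>t. (1/2 + of_nat m) * (sech_poly m t * exp (\<i> * of_real v * of_real t)) + \<i> * ((of_real t * sech_poly m t) * exp (\<i> * of_real v * of_real t)) \<partial>lborel)"
    by (intro Bochner_Integration.integral_cong) (simp_all add: sech_poly_Suc algebra_simps)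
  also have "\<dots> = (1/2 + of_nat m) * \<Phi> v + \<i> * \<Psi>"
    using i1 i2 by (simp add: \<Phi>_def \<Psi>_def)
  also have "\<dots> = of_real ((1/2 + real m) * (2 * fact m * exp (v / 2) / E ^ Suc m) +
       2 * fact m * exp (v / 2) * (1/2 / E ^ Suc m - (1 + real m) * exp v / E ^ Suc (Suc m)))"
    unfolding \<Psi> unfolding \<Phi>_def Suc.IH E_def by simp
  also have "(1/2 + real m) * (2 * fact m * exp (v / 2) / E ^ Suc m) +
       2 * fact m * exp (v / 2) * (1/2 / E ^ Suc m - (1 + real m) * exp v / E ^ Suc (Suc m))
      = 2 * fact m * exp (v / 2) * (1 + real m) * (E - exp v) / E ^ Suc (Suc m)"
    using E by (simp add: field_simps)
  also have "\<dots> = 2 * fact (Suc m) * exp (v / 2) / E ^ Suc (Suc m)" by (simp add: E_def mult_ac)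
  finally show ?case by (simp only: E_def)
qed

section \<open>Analytic continuation of the zeta function\<close>

text \<open>
  Mellin transforms are written on the logarithmic scale \<open>v = exp u\<close>. There the inversion \<open>v \<mapsto> 1/v\<close>, which the
  reciprocity law is about, is the reflection \<open>u \<mapsto> - u\<close>, and it folds the line at 0.
\<close>
lemma integral_split_at_0:
  fixes F :: "real \<Rightarrow> complex"
  assumes 1: "integrable lborel (\<lambda>u. indicator {0<..} u *\<^sub>R F u)" and 2: "integrable lborel (\<lambda>u. indicator {0<..} u *\<^sub>R F (- u))"
    and [measurable]: "F \<in> borel_measurable borel"
  shows "integrable lborel F"
    and "(\<integral>u. F u \<partial>lborel) = (\<integral>u. indicator {0<..} u *\<^sub>R F u \<partial>lborel) + (\<integral>u. indicator {0<..} u *\<^sub>R F (- u) \<partial>lborel)"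
proof -
  have neg': "integrable lborel (\<lambda>u. indicator {0<..} (- u) *\<^sub>R F u)"
    using lborel_integrable_real_affine[OF 2, of "-1" 0] by simp
  have eq2: "(\<integral>u. indicator {0<..} (- u) *\<^sub>R F u \<partial>lborel) = (\<integral>u. indicator {0<..} u *\<^sub>R F (- u) \<partial>lborel)"
    using lborel_integral_real_affine[of "-1" "\<lambda>u. indicator {0<..} u *\<^sub>R F (- u)" 0] by simp
  have ae: "AE u in lborel. indicator {0<..} u *\<^sub>R F u + indicator {0<..} (- u) *\<^sub>R F u = F u"
    by (rule eventually_mono[OF AE_lborel_singleton[of 0]]) (auto simp: indicator_def)
  have "integrable lborel (\<lambda>u. indicator {0<..} u *\<^sub>R F u + indicator {0<..} (- u) *\<^sub>R F u)"
    using 1 neg' by simp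
  thus "integrable lborel F"
    by (subst (asm) integrable_cong_AE[OF _ _ ae]) auto
  have "(\<integral>u. F u \<partial>lborel) = (\<integral>u. indicator {0<..} u *\<^sub>R F u + indicator {0<..} (- u) *\<^sub>R F u \<partial>lborel)"
    by (rule integral_cong_AE[symmetric]) (use ae in auto)
  also have "\<dots> = (\<integral>u. indicator {0<..} u *\<^sub>R F u \<partial>lborel) + (\<integral>u. indicator {0<..} (- u) *\<^sub>R F u \<partial>lborel)"
    using 1 neg' by simp
  finally show "(\<integral>u. F u \<partial>lborel) = (\<integral>u. indicator {0<..} u *\<^sub>R F u \<partial>lborel) + (\<integral>u. indicator {0<..} u *\<^sub>R F (- u) \<partial>lborel)"
    unfolding eq2 .
qed

lemma range_scaled_exp: "c > 0 \<Longrightarrow> range (\<lambda>u::real. c * exp (2 * u)) = {0<..}"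
proof safe
  fix y :: real assume "c > 0" "y > 0"
  hence "y = c * exp (2 * (ln (y / c) / 2))" by simp
  thus "y \<in> range (\<lambda>u. c * exp (2 * u))" by blast
qed auto

text \<open>
  Euler's integral for \<open>\<Gamma>(s/2)\<close> after the substitution \<open>t = \<pi> exp (2u)\<close>.
\<close>
lemma gaussian_mellin:
  assumes s: "Re s > 0"
  shows "has_bochner_integral lborel (\<lambda>u. of_real (exp (- pi * exp (2 * u))) * exp (s * of_real u))
     (of_real pi powr (- s / 2) * Gamma (s / 2) / 2)"
proof -
  define g :: "real \<Rightarrow> real" where "g u = pi * exp (2 * u)" for u
  define h where "h u = 2 * g u" for u
  define f :: "real \<Rightarrow> complex" where "f t = of_real t powr (s / 2 - 1) / of_real (exp t)" for t
  have deriv: "(g has_field_derivative h u) (at u)" for u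
    unfolding g_def h_def by (auto intro!: derivative_eq_intros)
  have inj: "inj g" by (auto simp: inj_def g_def)
  have g_pos: "g u > 0" and h_pos: "h u > 0" for u by (auto simp: g_def h_def)
  have range: "range g = {0<..}" unfolding g_def[abs_def] by (rule range_scaled_exp) simp
  have meas [measurable]: "g \<in> borel_measurable borel" "h \<in> borel_measurable borel" "f \<in> borel_measurable borel"
    by (simp_all add: g_def[abs_def] h_def[abs_def] f_def[abs_def])
  have val: "h u *\<^sub>R f (g u) = 2 * of_real pi powr (s / 2) * (of_real (exp (- pi * exp (2 * u))) * exp (s * of_real u))" for u
  proof -
    have ln_g: "ln (complex_of_real (g u)) = of_real (ln pi + 2 * u)"
      using g_pos[of u] by (subst Ln_of_real) (auto simp: g_def ln_mult)
    have "of_real (g u) * (of_real (g u) powr (s / 2 - 1)) = (of_real (g u) powr (s / 2) :: complex)"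
      using g_pos[of u] by (simp add: powr_diff)
    also have "\<dots> = exp (s / 2 * of_real (ln pi + 2 * u))"
      using g_pos[of u] by (simp only: powr_def ln_g) auto
    also have "\<dots> = exp (s / 2 * of_real (ln pi)) * exp (s * of_real u)"
      by (simp add: exp_add[symmetric] algebra_simps)
    also have "exp (s / 2 * of_real (ln pi)) = of_real pi powr (s / 2)"
      by (simp add: powr_def Ln_of_real)
    finally have *: "of_real (g u) * (of_real (g u) powr (s / 2 - 1)) = of_real pi powr (s / 2) * exp (s * of_real u)" .
    have "h u *\<^sub>R f (g u) = 2 * (of_real (g u) * (of_real (g u) powr (s / 2 - 1))) / of_real (exp (g u))"
      by (simp add: h_def f_def scaleR_conv_of_real)
    also have "\<dots> = 2 * of_real pi powr (s / 2) * (of_real (exp (- g u)) * exp (s * of_real u))"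
      unfolding * by (simp add: exp_minus field_simps)
    finally show ?thesis by (simp add: g_def)
  qed
  have int: "set_integrable lebesgue {0<..} f"
    using absolutely_integrable_Gamma_integral'[of "s / 2"] s unfolding f_def[abs_def] by simp
  have int': "set_integrable lborel {0<..} f"
    using int unfolding set_integrable_def by (subst (asm) integrable_completion) auto
  have "(LINT t:{0<..}|lborel. f t) = (LINT t:{0<..}|lebesgue. f t)"
    unfolding set_lebesgue_integral_def by (rule integral_completion[symmetric]) measurable
  also have "\<dots> = integral {0<..} f" using int by (rule set_lebesgue_integral_eq_integral(2))
  also have "\<dots> = Gamma (s / 2)"
    using Gamma_integral_complex'[of "s / 2"] s unfolding f_def by (simp add: integral_unique)
  finally have I: "(LINT t:{0<..}|lborel. f t) = Gamma (s / 2)" .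
  have "has_bochner_integral lborel (\<lambda>u. h u *\<^sub>R f (g u)) (Gamma (s / 2))"
    using lborel_integral_substitution_UNIV[of g h f, OF deriv inj h_pos] int' I
    unfolding range has_bochner_integral_iff by auto
  hence "has_bochner_integral lborel (\<lambda>u. of_real pi powr (- s / 2) / 2 * (h u *\<^sub>R f (g u))) (of_real pi powr (- s / 2) / 2 * Gamma (s / 2))"
    by (rule has_bochner_integral_mult_right)
  also have "(\<lambda>u. of_real pi powr (- s / 2) / 2 * (h u *\<^sub>R f (g u))) = (\<lambda>u. of_real (exp (- pi * exp (2 * u))) * exp (s * of_real u))"
    unfolding val by (simp add: fun_eq_iff powr_minus field_simps)
  finally show ?thesis by (simp add: mult_ac)
qed

text \<open>
  The factor \<open>n\<^sup>2\<close> is a translation by \<open>ln n\<close> on the logarithmic scale; it produces \<open>n^(-s)\<close>.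
\<close>
lemma gaussian_mellin_scaled:
  assumes s: "Re s > 0" and n: "n > 0"
  shows "has_bochner_integral lborel (\<lambda>u. of_real (exp (- pi * (real n)\<^sup>2 * (exp u)\<^sup>2)) * exp (s * of_real u))
     (1 / of_nat n powr s * (of_real pi powr (- s / 2) * Gamma (s / 2) / 2))"
proof -
  have ln_n: "ln (of_nat n :: complex) = of_real (ln (real n))"
    using n by (metis Ln_of_real of_nat_0_less_iff of_real_of_nat_eq)
  have shift: "of_real (exp (- pi * (real n)\<^sup>2 * (exp u)\<^sup>2)) * exp (s * of_real u) = 
    1 / of_nat n powr s * (of_real (exp (- pi * exp (2 * (ln (real n) + 1 * u)))) * exp (s * of_real (ln (real n) + 1 * u)))" for u
  proof -
    have "exp (2 * (ln (real n) + 1 * u)) = (real n)\<^sup>2 * (exp u)\<^sup>2"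
    proof -
      have "exp (2 * (ln (real n) + 1 * u)) = exp ((ln (real n) + u) + (ln (real n) + u))" by simp
      thus ?thesis using n by (simp only: exp_add power2_eq_square) simp
    qed
    moreover have "of_nat n powr s = exp (s * of_real (ln (real n)))"
      using n by (simp add: powr_def ln_n)
    moreover have "exp (s * of_real (ln (real n) + 1 * u)) = exp (s * of_real (ln (real n))) * exp (s * of_real u)"
      by (simp add: exp_add[symmetric] algebra_simps)
    ultimately show ?thesis by (simp add: mult.assoc)
  qed
  have "has_bochner_integral lborel (\<lambda>u. of_real (exp (- pi * exp (2 * (ln (real n) + 1 * u)))) * exp (s * of_real (ln (real n) + 1 * u)))
     (of_real pi powr (- s / 2) * Gamma (s / 2) / 2)"
    using lborel_has_bochner_integral_real_affine_iff[of 1 "\<lambda>u. of_real (exp (- pi * exp (2 * u))) * exp (s * of_real u)" _ "ln (real n)"]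
      gaussian_mellin[OF s] by simp
  thus ?thesis unfolding shift by (rule has_bochner_integral_mult_right)
qed

lemma borel_measurable_gauss_sum [measurable]: "gauss_sum \<in> borel_measurable borel"
  unfolding gauss_sum_def[abs_def] by measurable

lemma gauss_sum_sums: "v > 0 \<Longrightarrow> (\<lambda>n. exp (- pi * (real (Suc n))\<^sup>2 * v\<^sup>2)) sums gauss_sum v"
  unfolding gauss_sum_def by (intro summable_sums summable_gauss_sum) auto

text \<open>
  Integration term by term. The series of the norms of the integrands integrates to the same formula at \<open>Re s\<close>,
  which is finite because \<open>Re s > 1\<close>.
\<close>
lemma gauss_sum_mellin:
  assumes s: "Re s > 1"
  shows "integrable lborel (\<lambda>u. of_real (gauss_sum (exp u)) * exp (s * of_real u))"
    and "(\<lambda>n. 1 / of_nat (Suc n) powr s * (of_real pi powr (- s / 2) * Gamma (s / 2) / 2)) sums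
      (\<integral>u. of_real (gauss_sum (exp u)) * exp (s * of_real u) \<partial>lborel)"
proof -
  define q :: "nat \<Rightarrow> real \<Rightarrow> complex" where
    "q n u = of_real (exp (- pi * (real (Suc n))\<^sup>2 * (exp u)\<^sup>2)) * exp (s * of_real u)" for n u
  have q: "has_bochner_integral lborel (q n) (1 / of_nat (Suc n) powr s * (of_real pi powr (- s / 2) * Gamma (s / 2) / 2))" for n
    unfolding q_def[abs_def] using s by (intro gaussian_mellin_scaled) auto
  define r where "r = complex_of_real (Re s)"
  define c where "c = of_real pi powr (- r / 2) * Gamma (r / 2) / 2"
  have norm_q: "(\<integral>u. norm (q n u) \<partial>lborel) = norm (1 / of_nat (Suc n) powr r * c)" for n
  proof -
    have "has_bochner_integral lborel (\<lambda>u. complex_of_real (norm (q n u))) (1 / of_nat (Suc n) powr r * c)"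
    proof -
      have "(\<lambda>u. complex_of_real (norm (q n u))) = (\<lambda>u. of_real (exp (- pi * (real (Suc n))\<^sup>2 * (exp u)\<^sup>2)) * exp (r * of_real u))"
        by (auto simp: fun_eq_iff q_def norm_mult r_def simp flip: exp_of_real)
      thus ?thesis using gaussian_mellin_scaled[of r "Suc n"] s by (simp add: r_def c_def)
    qed
    hence "complex_of_real (\<integral>u. norm (q n u) \<partial>lborel) = 1 / of_nat (Suc n) powr r * c"
      by (simp add: has_bochner_integral_iff)
    hence "norm (complex_of_real (\<integral>u. norm (q n u) \<partial>lborel)) = norm (1 / of_nat (Suc n) powr r * c)" by simp
    thus ?thesis by simp
  qed
  have "summable (\<lambda>n. real (Suc n) powr (- Re s))"
    using s summable_real_powr_iff[of "- Re s"] summable_Suc_iff[of "\<lambda>n. real n powr (- Re s)"] by simp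
  moreover have "norm (1 / of_nat (Suc n) powr r * c) = real (Suc n) powr (- Re s) * norm c" for n
  proof -
    have "of_nat (Suc n) powr r = complex_of_real (real (Suc n) powr Re s)"
      unfolding r_def using powr_of_real[of "real (Suc n)" "Re s"] by simp
    thus ?thesis by (simp add: norm_mult norm_divide powr_minus_divide del: of_nat_Suc)
  qed
  ultimately have summable: "summable (\<lambda>n. \<integral>u. norm (q n u) \<partial>lborel)"
    unfolding norm_q by (simp add: summable_mult2)
  have q_sums: "(\<lambda>n. q n u) sums (of_real (gauss_sum (exp u)) * exp (s * of_real u))" for u
    unfolding q_def by (intro sums_mult2 sums_of_real gauss_sum_sums) auto
  have "(\<lambda>n. norm (q n u)) sums (gauss_sum (exp u) * exp (Re s * u))" for u
    unfolding q_def norm_mult norm_of_real abs_exp_cancel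
    using sums_mult2[OF gauss_sum_sums[of "exp u"], of "exp (Re s * u)"] by simp
  hence ae: "AE u in lborel. summable (\<lambda>n. norm (q n u))" by (auto simp: sums_iff)
  have int: "integrable lborel (q n)" for n using q[of n] by (simp add: has_bochner_integral_iff)
  have eq: "(\<lambda>u. \<Sum>n. q n u) = (\<lambda>u. of_real (gauss_sum (exp u)) * exp (s * of_real u))"
    using q_sums by (auto simp: sums_iff)
  show "integrable lborel (\<lambda>u. of_real (gauss_sum (exp u)) * exp (s * of_real u))"
    using integrable_suminf[OF int ae summable] unfolding eq .
  have "(\<lambda>n. integral\<^sup>L lborel (q n)) sums (\<integral>u. (\<Sum>n. q n u) \<partial>lborel)"
    by (rule sums_integral[OF int ae summable])
  thus "(\<lambda>n. 1 / of_nat (Suc n) powr s * (of_real pi powr (- s / 2) * Gamma (s / 2) / 2)) sums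
      (\<integral>u. of_real (gauss_sum (exp u)) * exp (s * of_real u) \<partial>lborel)"
    unfolding eq using q by (simp add: has_bochner_integral_iff)
qed

lemma integral_exp_halfline:
  assumes c: "Re c > 0"
  shows "has_bochner_integral lborel (\<lambda>u. indicator {0<..} u *\<^sub>R exp (- c * of_real u)) (1 / c)"
proof -
  have "set_integrable lborel {0<..} (\<lambda>u. exp (- (u * Re c)))"
    using c by (rule integrable_I0i_exp_mscale)
  hence int: "set_integrable lborel {0<..} (\<lambda>u. exp (- c * of_real u))"
    unfolding set_integrable_def
  proof (rule Bochner_Integration.integrable_bound)
    show "AE u in lborel. norm (indicator {0<..} u *\<^sub>R exp (- c * of_real u)) \<le> norm (indicator {0<..} u *\<^sub>R exp (- (u * Re c)))"
      by (intro AE_I2) (auto simp: indicator_def mult.commute)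
  qed auto
  have "(LBINT u=0..\<infinity>. exp (- c * of_real u)) = 0 - (- 1 / c)"
  proof (rule interval_integral_FTC_integrable[where F = "\<lambda>u. - exp (- c * of_real u) / c"])
    show "((\<lambda>u. - exp (- c * of_real u) / c) has_vector_derivative exp (- c * of_real x)) (at x)" for x
    proof -
      have "((\<lambda>z. - exp (- c * z) / c) has_field_derivative exp (- c * of_real x)) (at (of_real x))"
        using c by (auto intro!: derivative_eq_intros)
      thus ?thesis by (rule has_vector_derivative_real_field)
    qed
    show "set_integrable lborel (einterval 0 \<infinity>) (\<lambda>u. exp (- c * of_real u))"
      using int by (simp add: einterval_def greaterThan_def zero_ereal_def)
    have "((\<lambda>u. - exp (- c * of_real u) / c) \<longlongrightarrow> - exp (- c * of_real 0) / c) (at_right 0)"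
      using c by (intro tendsto_intros) auto
    thus "(((\<lambda>u. - exp (- c * of_real u) / c) \<circ> real_of_ereal) \<longlongrightarrow> - 1 / c) (at_right 0)"
      unfolding zero_ereal_def ereal_tendsto_simps by simp
    have "((\<lambda>u. exp (- (Re c * u))) \<longlongrightarrow> 0) at_top"
      using c by real_asymp
    hence "((\<lambda>u. norm (exp (- c * of_real u))) \<longlongrightarrow> 0) at_top" by simp
    hence "((\<lambda>u. exp (- c * of_real u)) \<longlongrightarrow> 0) at_top" by (rule tendsto_norm_zero_cancel)
    hence "((\<lambda>u. - exp (- c * of_real u) / c) \<longlongrightarrow> - 0 / c) at_top"
      using c by (intro tendsto_intros) auto
    thus "(((\<lambda>u. - exp (- c * of_real u) / c) \<circ> real_of_ereal) \<longlongrightarrow> 0) (at_left \<infinity>)"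
      unfolding ereal_tendsto_simps by simp
  qed (auto intro!: continuous_intros)
  with int show ?thesis
    by (simp add: has_bochner_integral_iff set_integrable_def interval_lebesgue_integral_0_infty set_lebesgue_integral_def)
qed

definition theta_tail :: "real \<Rightarrow> complex" where
  "theta_tail u = indicator {0<..} u *\<^sub>R of_real (2 * gauss_sum (exp u))"

text \<open>
  Riemann's entire function: the completed zeta function \<open>\<pi>^(-s/2) \<Gamma>(s/2) \<zeta>(s)\<close> is this plus \<open>1/(s-1) - 1/s\<close>.
\<close>
definition completed_zeta_entire :: "complex \<Rightarrow> complex" where
  "completed_zeta_entire s = (\<integral>u. theta_tail u * exp (s * of_real u) \<partial>lborel) + (\<integral>u. theta_tail u * exp ((1 - s) * of_real u) \<partial>lborel)"

lemma theta_tail_measurable [measurable]: "theta_tail \<in> borel_measurable borel"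
  unfolding theta_tail_def[abs_def] by measurable

text \<open>
  On the half-line \<open>u > 0\<close> every exponential weight is dominated by one with exponent at least 2, where the
  Mellin transform converges.
\<close>
lemma integrable_theta_tail_exp_abs: "integrable lborel (\<lambda>u. norm (theta_tail u) * exp (R * \<bar>u\<bar>))"
proof (rule Bochner_Integration.integrable_bound)
  show "integrable lborel (\<lambda>u. 2 * norm (of_real (gauss_sum (exp u)) * exp (of_real (max R 2) * of_real u) :: complex))"
    by (intro integrable_mult_right integrable_norm gauss_sum_mellin) auto
  show "AE u in lborel. norm (norm (theta_tail u) * exp (R * \<bar>u\<bar>))
      \<le> norm (2 * norm (of_real (gauss_sum (exp u)) * exp (of_real (max R 2) * of_real u) :: complex))"
  proof (rule AE_I2)
    fix u :: real
    show "norm (norm (theta_tail u) * exp (R * \<bar>u\<bar>)) \<le> norm (2 * norm (of_real (gauss_sum (exp u)) * exp (of_real (max R 2) * of_real u) :: complex))"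
    proof (cases "u > 0")
      case True
      hence "R * \<bar>u\<bar> \<le> max R 2 * u" by (auto intro!: mult_right_mono)
      thus ?thesis using True by (auto simp: theta_tail_def norm_mult intro!: mult_left_mono)
    qed (simp add: theta_tail_def)
  qed
qed simp

lemma integrable_theta_tail_exp: "integrable lborel (\<lambda>u. theta_tail u * exp (s * of_real u))"
  by (rule laplace_integrable[OF _ integrable_theta_tail_exp_abs[of "\<bar>Re s\<bar>"]]) auto

lemma holomorphic_completed_zeta_entire: "completed_zeta_entire holomorphic_on UNIV"
proof -
  have *: "(\<lambda>s. \<integral>u. theta_tail u * exp (s * of_real u) \<partial>lborel) holomorphic_on UNIV"
  proof (rule holomorphic_onI)
    fix s :: complex
    show "(\<lambda>s. \<integral>u. theta_tail u * exp (s * of_real u) \<partial>lborel) field_differentiable at s within UNIV"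
      using laplace_has_derivative[OF _ integrable_theta_tail_exp_abs[of "\<bar>Re s\<bar> + 1"], of s]
      by (auto simp: field_differentiable_def)
  qed
  have "(\<lambda>s. \<integral>u. theta_tail u * exp ((1 - s) * of_real u) \<partial>lborel) holomorphic_on UNIV"
  proof -
    have c: "(\<lambda>s :: complex. 1 - s) holomorphic_on UNIV" by (intro holomorphic_intros)
    show ?thesis
      using holomorphic_on_compose[OF c holomorphic_on_subset[OF *]] by (simp add: o_def)
  qed
  with * show ?thesis unfolding completed_zeta_entire_def[abs_def] by (intro holomorphic_intros)
qed

lemma gauss_sum_exp_uminus: "2 * gauss_sum (exp (- u)) = exp u + exp u * (2 * gauss_sum (exp u)) - 1"
  using gauss_sum_reciprocity[of "exp u"] by (simp add: exp_minus inverse_eq_divide algebra_simps)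

text \<open>
  The half \<open>u < 0\<close> of the Mellin integral is reflected to \<open>u > 0\<close> with the reciprocity law, whose two elementary
  terms contribute the poles.
\<close>
lemma gauss_sum_mellin_eq:
  assumes s: "Re s > 1"
  shows "2 * (\<integral>u. of_real (gauss_sum (exp u)) * exp (s * of_real u) \<partial>lborel) = completed_zeta_entire s + 1 / (s - 1) - 1 / s"
proof -
  let ?F = "\<lambda>u. of_real (gauss_sum (exp u)) * exp (s * of_real u)"
  have pos: "(\<lambda>u. indicator {0<..} u *\<^sub>R ?F u) = (\<lambda>u. 1 / 2 * (theta_tail u * exp (s * of_real u)))"
    by (auto simp: theta_tail_def fun_eq_iff indicator_def)
  have neg: "(\<lambda>u. indicator {0<..} u *\<^sub>R ?F (- u)) = (\<lambda>u. 1 / 2 * (indicator {0<..} u *\<^sub>R exp (- (s - 1) * of_real u)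
     + theta_tail u * exp ((1 - s) * of_real u) - indicator {0<..} u *\<^sub>R exp (- s * of_real u)))"
  proof
    fix u :: real
    have "?F (- u) = 1 / 2 * of_real (2 * gauss_sum (exp (- u))) * exp (- s * of_real u)" by simp
    also have "\<dots> = 1 / 2 * (of_real (exp u) * exp (- s * of_real u) + of_real (2 * gauss_sum (exp u)) * (of_real (exp u) * exp (- s * of_real u)) - exp (- s * of_real u))"
      unfolding gauss_sum_exp_uminus by (simp add: algebra_simps)
    also have "of_real (exp u) * exp (- s * of_real u) = exp ((1 - s) * of_real u)"
      by (simp add: algebra_simps exp_diff flip: exp_of_real exp_add)
    finally show "indicator {0<..} u *\<^sub>R ?F (- u) = 1 / 2 * (indicator {0<..} u *\<^sub>R exp (- (s - 1) * of_real u)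
     + theta_tail u * exp ((1 - s) * of_real u) - indicator {0<..} u *\<^sub>R exp (- s * of_real u))"
      by (cases "u > 0") (auto simp: theta_tail_def)
  qed
  have e1: "has_bochner_integral lborel (\<lambda>u. indicator {0<..} u *\<^sub>R exp (- (s - 1) * of_real u)) (1 / (s - 1))"
    by (rule integral_exp_halfline) (use s in auto)
  have e2: "has_bochner_integral lborel (\<lambda>u. indicator {0<..} u *\<^sub>R exp (- s * of_real u)) (1 / s)"
    by (rule integral_exp_halfline) (use s in auto)
  have P: "has_bochner_integral lborel (\<lambda>u. indicator {0<..} u *\<^sub>R ?F u) (1 / 2 * (\<integral>u. theta_tail u * exp (s * of_real u) \<partial>lborel))"
    unfolding pos by (intro has_bochner_integral_mult_right has_bochner_integral_integrable integrable_theta_tail_exp)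
  have N: "has_bochner_integral lborel (\<lambda>u. indicator {0<..} u *\<^sub>R ?F (- u))
     (1 / 2 * (1 / (s - 1) + (\<integral>u. theta_tail u * exp ((1 - s) * of_real u) \<partial>lborel) - 1 / s))"
    unfolding neg by (intro has_bochner_integral_mult_right has_bochner_integral_diff has_bochner_integral_add
      e1 e2 has_bochner_integral_integrable integrable_theta_tail_exp)
  have "(\<integral>u. ?F u \<partial>lborel) = (\<integral>u. indicator {0<..} u *\<^sub>R ?F u \<partial>lborel) + (\<integral>u. indicator {0<..} u *\<^sub>R ?F (- u) \<partial>lborel)"
    by (rule integral_split_at_0(2)) (use P N in \<open>auto simp only: has_bochner_integral_iff\<close>, measurable)
  also have "\<dots> = 1 / 2 * (completed_zeta_entire s + 1 / (s - 1) - 1 / s)"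
    unfolding has_bochner_integral_integral_eq[OF P] has_bochner_integral_integral_eq[OF N]
    by (simp only: completed_zeta_entire_def algebra_simps)
  finally show ?thesis by (simp add: mult.commute)
qed

text \<open>
  Dividing the completed zeta function by \<open>\<Gamma>(s/2)\<close> cancels its pole at 0. To see this in the formula,
  \<open>1 / (s \<Gamma>(s/2))\<close> is replaced by \<open>1 / (2 \<Gamma>(s/2 + 1))\<close>.
\<close>
definition zeta_continuation :: "complex \<Rightarrow> complex" where
  "zeta_continuation s = of_real pi powr (s / 2) *
     (rGamma (s / 2) * (completed_zeta_entire s + 1 / (s - 1)) - rGamma (s / 2 + 1) / 2)"

lemma zeta_continuation_eq:
  assumes "s \<noteq> 0"
  shows "zeta_continuation s = of_real pi powr (s / 2) * rGamma (s / 2) * (completed_zeta_entire s + 1 / (s - 1) - 1 / s)"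
proof -
  have "rGamma (s / 2 + 1) / 2 = rGamma (s / 2) * (1 / s)"
    using rGamma_plus1[of "s / 2"] assms by (simp add: field_simps)
  thus ?thesis unfolding zeta_continuation_def by (simp only: algebra_simps)
qed

lemma holomorphic_zeta_continuation: "zeta_continuation holomorphic_on - {1}"
  unfolding zeta_continuation_def[abs_def]
  by (intro holomorphic_intros holomorphic_on_subset[OF holomorphic_completed_zeta_entire]) auto

lemma half_not_nonpos_Int: "Re s > 0 \<Longrightarrow> s / 2 \<notin> \<int>\<^sub>\<le>\<^sub>0"
proof
  assume s: "Re s > 0" and "s / 2 \<in> \<int>\<^sub>\<le>\<^sub>0"
  then obtain n where n: "s / 2 = of_int n" "n \<le> 0" by (auto elim!: nonpos_Ints_cases)
  have "Re s / 2 = of_int n" using arg_cong[OF n(1), of Re] by simp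
  thus False using s n(2) by simp
qed

lemma zeta_continuation_sums:
  assumes s: "Re s > 1"
  shows "(\<lambda>n. 1 / of_nat (Suc n) powr s) sums zeta_continuation s"
proof -
  have nz: "s \<noteq> 0" "Gamma (s / 2) \<noteq> 0" using s half_not_nonpos_Int[of s] by (auto simp: Gamma_eq_zero_iff)
  let ?c = "of_real pi powr (- s / 2) * Gamma (s / 2) / 2 :: complex"
  have c: "?c \<noteq> 0" using nz by simp
  have "(\<lambda>n. (1 / of_nat (Suc n) powr s * ?c) / ?c) sums ((1 / 2 * (completed_zeta_entire s + 1 / (s - 1) - 1 / s)) / ?c)"
    using sums_divide[OF gauss_sum_mellin(2)[OF s], of ?c] unfolding gauss_sum_mellin_eq[OF s, symmetric] by simp
  also have "(\<lambda>n. (1 / of_nat (Suc n) powr s * ?c) / ?c) = (\<lambda>n. 1 / of_nat (Suc n) powr s)"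
    using c by simp
  also have "(1 / 2 * (completed_zeta_entire s + 1 / (s - 1) - 1 / s)) / ?c = zeta_continuation s"
    using nz unfolding zeta_continuation_eq[OF nz(1)] by (simp add: powr_minus rGamma_inverse_Gamma field_simps)
  finally show ?thesis .
qed

theorem riemann_zeta_eq:
  assumes "s \<noteq> 1"
  shows "riemann_zeta s = zeta_continuation s"
proof -
  let ?P = "\<lambda>f. f holomorphic_on (- {1}) \<and> (\<forall>s. Re s > 1 \<longrightarrow> (\<lambda>n. 1 / of_nat (Suc n) powr s) sums f s)"
  have "?P riemann_zeta" unfolding riemann_zeta_def
    by (rule someI[of ?P zeta_continuation]) (use holomorphic_zeta_continuation zeta_continuation_sums in auto)
  hence Z: "riemann_zeta holomorphic_on - {1}" "\<And>s. Re s > 1 \<Longrightarrow> (\<lambda>n. 1 / of_nat (Suc n) powr s) sums riemann_zeta s"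
    by auto
  have "riemann_zeta s - zeta_continuation s = 0"
  proof (rule analytic_continuation[where f = "\<lambda>s. riemann_zeta s - zeta_continuation s" and S = "- {1}" and U = "{s. Re s > 1}" and \<xi> = 2])
    show "(\<lambda>s. riemann_zeta s - zeta_continuation s) holomorphic_on - {1}"
      by (intro holomorphic_intros Z holomorphic_zeta_continuation)
    show "connected (- {1::complex})" by (rule connected_punctured_universe) simp
    have "(2::complex) \<in> interior {s. Re s > 1}"
      by (subst interior_open) (auto simp: open_halfspace_Re_gt)
    thus "(2::complex) islimpt {s. Re s > 1}" by (rule interior_limit_point)
    fix s :: complex assume "s \<in> {s. Re s > 1}"
    thus "riemann_zeta s - zeta_continuation s = 0"
      using Z(2)[of s] zeta_continuation_sums[of s] by (auto dest: sums_unique2)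
  qed (use assms in auto)
  thus ?thesis by simp
qed

section \<open>The xi function on the critical line\<close>

text \<open>
  The weight \<open>exp (u/2)\<close> belongs to the critical line: the Mellin integral of \<open>gauss_defect\<close> at \<open>1/2 + it\<close> is the
  Fourier integral of this function at \<open>t\<close>.
\<close>
definition xi_kernel :: "real \<Rightarrow> real" where
  "xi_kernel u = exp (u / 2) * gauss_defect (exp u)"

text \<open>
  The reciprocity law in its symmetric form; it is the functional equation \<open>\<Xi>(-t) = \<Xi>(t)\<close>.
\<close>
lemma xi_kernel_even: "xi_kernel (- u) = xi_kernel u"
proof -
  have "gauss_defect (exp (- u)) = exp u / 2 - gauss_sum (exp (- u))"
  proof -
    have "1 / (2 * exp (- u)) = exp u / 2" by (simp add: exp_minus field_simps)
    thus ?thesis by (simp add: gauss_defect_def)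
  qed
  also have "\<dots> = 1 / 2 - exp u * gauss_sum (exp u)"
    using gauss_sum_exp_uminus[of u] by simp
  also have "\<dots> = exp u * gauss_defect (exp u)"
    by (simp add: gauss_defect_def right_diff_distrib)
  finally have "gauss_defect (exp (- u)) = exp u * gauss_defect (exp u)" .
  moreover have "exp u = exp (u / 2) * exp (u / 2)" by (simp flip: exp_add)
  ultimately show ?thesis by (simp add: xi_kernel_def exp_minus field_simps)
qed

lemma xi_kernel_measurable [measurable]: "xi_kernel \<in> borel_measurable borel"
  unfolding xi_kernel_def[abs_def] gauss_defect_def[abs_def] by measurable

text \<open>
  Subtracting \<open>\<omega>(v)\<close> from \<open>1/(2v)\<close> makes the Mellin integral converge in the critical strip. For \<open>u > 0\<close> the term
  \<open>1/(2v)\<close> contributes the elementary terms at \<open>\<plusminus>t\<close>, and \<open>\<omega>\<close> the two halves of the entire function.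
\<close>
lemma xi_kernel_fourier:
  shows "integrable lborel (\<lambda>u. of_real (xi_kernel u) * exp (\<i> * of_real t * of_real u))"
    and "(\<integral>u. of_real (xi_kernel u) * exp (\<i> * of_real t * of_real u) \<partial>lborel) =
      - (1 / 2) * (completed_zeta_entire (1 / 2 + \<i> * of_real t) + 1 / ((1 / 2 + \<i> * of_real t) - 1) - 1 / (1 / 2 + \<i> * of_real t))"
proof -
  let ?F = "\<lambda>t u. of_real (xi_kernel u) * exp (\<i> * of_real t * of_real u)"
  have half: "(\<lambda>u. indicator {0<..} u *\<^sub>R ?F t u) = (\<lambda>u. 1 / 2 * (indicator {0<..} u *\<^sub>R exp (- (1 / 2 - \<i> * of_real t) * of_real u)
     - theta_tail u * exp ((1 / 2 + \<i> * of_real t) * of_real u)))" for t :: real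
  proof
    fix u :: real
    have 1: "exp (u / 2) / exp u = exp (- (u / 2))" by (simp flip: exp_diff)
    have "?F t u = 1 / 2 * (of_real (exp (u / 2) / exp u) * exp (\<i> * of_real t * of_real u) - of_real (2 * gauss_sum (exp u)) * (of_real (exp (u / 2)) * exp (\<i> * of_real t * of_real u)))"
      by (simp add: xi_kernel_def gauss_defect_def field_simps)
    also have "of_real (exp (u / 2)) * exp (\<i> * of_real t * of_real u) = exp ((1 / 2 + \<i> * of_real t) * of_real u)"
      by (simp add: distrib_right exp_add flip: exp_of_real)
    also have "of_real (exp (u / 2) / exp u) * exp (\<i> * of_real t * of_real u) = exp (- (1 / 2 - \<i> * of_real t) * of_real u)"
      unfolding 1 exp_of_real by (simp add: algebra_simps flip: exp_add exp_of_real)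
    finally show "indicator {0<..} u *\<^sub>R ?F t u = 1 / 2 * (indicator {0<..} u *\<^sub>R exp (- (1 / 2 - \<i> * of_real t) * of_real u)
     - theta_tail u * exp ((1 / 2 + \<i> * of_real t) * of_real u))"
      by (cases "u > 0") (auto simp: theta_tail_def)
  qed
  have e: "has_bochner_integral lborel (\<lambda>u. indicator {0<..} u *\<^sub>R exp (- (1 / 2 - \<i> * of_real t) * of_real u)) (1 / (1 / 2 - \<i> * of_real t))" for t :: real
    by (rule integral_exp_halfline) auto
  have val: "has_bochner_integral lborel (\<lambda>u. indicator {0<..} u *\<^sub>R ?F t u)
     (1 / 2 * (1 / (1 / 2 - \<i> * of_real t) - (\<integral>u. theta_tail u * exp ((1 / 2 + \<i> * of_real t) * of_real u) \<partial>lborel)))" for t :: real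
    unfolding half by (intro has_bochner_integral_mult_right has_bochner_integral_diff e has_bochner_integral_integrable integrable_theta_tail_exp)
  have neg: "(\<lambda>u. indicator {0<..} u *\<^sub>R ?F t (- u)) = (\<lambda>u. indicator {0<..} u *\<^sub>R ?F (- t) u)" for t :: real
    by (simp add: xi_kernel_even)
  have int: "integrable lborel (\<lambda>u. indicator {0<..} u *\<^sub>R ?F t u)" "integrable lborel (\<lambda>u. indicator {0<..} u *\<^sub>R ?F t (- u))"
    unfolding neg using val[of t] val[of "- t"] unfolding has_bochner_integral_iff by auto
  show "integrable lborel (?F t)"
    by (rule integral_split_at_0(1)[OF int]) measurable
  have "(\<integral>u. ?F t u \<partial>lborel) = (\<integral>u. indicator {0<..} u *\<^sub>R ?F t u \<partial>lborel) + (\<integral>u. indicator {0<..} u *\<^sub>R ?F (- t) u \<partial>lborel)"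
    unfolding neg[symmetric] by (rule integral_split_at_0(2)[OF int]) measurable
  also have "\<dots> = 1 / 2 * (1 / (1 / 2 - \<i> * of_real t) - (\<integral>u. theta_tail u * exp ((1 / 2 + \<i> * of_real t) * of_real u) \<partial>lborel))
     + 1 / 2 * (1 / (1 / 2 - \<i> * of_real (- t)) - (\<integral>u. theta_tail u * exp ((1 / 2 + \<i> * of_real (- t)) * of_real u) \<partial>lborel))"
    unfolding has_bochner_integral_integral_eq[OF val[of t]] has_bochner_integral_integral_eq[OF val[of "- t"]] ..
  also have "\<dots> = - (1 / 2) * (completed_zeta_entire (1 / 2 + \<i> * of_real t) - 1 / (1 / 2 - \<i> * of_real t) - 1 / (1 / 2 + \<i> * of_real t))"
    by (simp add: completed_zeta_entire_def algebra_simps)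
  also have "1 / (1 / 2 - \<i> * of_real t) = - (1 / ((1 / 2 + \<i> * of_real t) - 1))"
    by (simp add: field_simps)
  finally show "(\<integral>u. ?F t u \<partial>lborel) = - (1 / 2) * (completed_zeta_entire (1 / 2 + \<i> * of_real t) + 1 / ((1 / 2 + \<i> * of_real t) - 1) - 1 / (1 / 2 + \<i> * of_real t))"
    by simp
qed

text \<open>
  In the open critical strip the bare product is holomorphic, so filling in singularities does not change it, and
  \<open>s (s - 1) = - (t\<^sup>2 + 1/4)\<close> for \<open>s = 1/2 + it\<close>.
\<close>
theorem riemann_Xi_fourier:
  "riemann_Xi (of_real t) = of_real (t\<^sup>2 + 1 / 4) * (\<integral>u. of_real (xi_kernel u) * exp (\<i> * of_real t * of_real u) \<partial>lborel)"
proof -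
  define s :: complex where "s = 1 / 2 + \<i> * of_real t"
  define S where "S = {s :: complex. 0 < Re s \<and> Re s < 1}"
  define P where "P s = 1 / 2 * s * (s - 1) * of_real pi powr (- s / 2) * Gamma (s / 2) * riemann_zeta s" for s :: complex
  have s: "s \<in> S" "s \<noteq> 0" "s \<noteq> 1" by (auto simp: s_def S_def complex_eq_iff)
  have "S = {s. Re s > 0} \<inter> {s. Re s < 1}" by (auto simp: S_def)
  hence open_S: "open S" by (auto intro!: open_Int open_halfspace_Re_lt open_halfspace_Re_gt)
  have npi: "z / 2 \<notin> \<int>\<^sub>\<le>\<^sub>0" if "z \<in> S" for z :: complex
    using that by (intro half_not_nonpos_Int) (simp add: S_def)
  have "P holomorphic_on S"
  proof -
    have z: "riemann_zeta holomorphic_on S"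
      by (rule holomorphic_transform[OF holomorphic_on_subset[OF holomorphic_zeta_continuation]])
         (auto simp: S_def intro!: riemann_zeta_eq[symmetric])
    show ?thesis unfolding P_def[abs_def] using npi by (intro holomorphic_intros z) auto
  qed
  hence "P analytic_on {s}" using open_S s(1) by (meson analytic_at)
  hence "remove_sings P s = P s" by (rule remove_sings_at_analytic)
  hence "riemann_Xi (of_real t) = P s"
    by (simp add: riemann_Xi_def riemann_xi_def P_def[abs_def] s_def)
  also have "\<dots> = 1 / 2 * s * (s - 1) * (of_real pi powr (- s / 2) * of_real pi powr (s / 2)) * (Gamma (s / 2) * rGamma (s / 2))
      * (completed_zeta_entire s + 1 / (s - 1) - 1 / s)"
    unfolding P_def riemann_zeta_eq[OF s(3)] zeta_continuation_eq[OF s(2)] by (simp add: mult_ac)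
  also have "of_real pi powr (- s / 2) * of_real pi powr (s / 2) = (1 :: complex)"
    by (simp add: powr_minus)
  also have "Gamma (s / 2) * rGamma (s / 2) = 1"
    using npi[OF s(1)] by (simp add: rGamma_inverse_Gamma Gamma_eq_zero_iff)
  finally have "riemann_Xi (of_real t) = (- (s * (s - 1))) * (- (1 / 2) * (completed_zeta_entire s + 1 / (s - 1) - 1 / s))"
    by (simp only: mult_minus_left mult_minus_right minus_minus mult_1_right) simp
  also have "- (s * (s - 1)) = of_real (t\<^sup>2 + 1 / 4)"
    by (simp add: s_def algebra_simps power2_eq_square)
  finally show ?thesis unfolding xi_kernel_fourier(2) s_def .
qed

section \<open>Integral minus sum\<close>

text \<open>
  For decreasing \<open>f\<close> this is the integral of \<open>f\<close> over the positive half-line minus the sum of \<open>f\<close> over the positive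
  integers. It is grouped by unit intervals, so that all terms are nonnegative and the value makes sense even if
  integral and sum are both infinite.
\<close>
definition euler_defect :: "(real \<Rightarrow> real) \<Rightarrow> ennreal" where
  "euler_defect f = (\<Sum>n. \<integral>\<^sup>+u. indicator {real n<..real (Suc n)} u * ennreal (f u - f (real (Suc n))) \<partial>lborel)"

text \<open>
  The partial sums of the series are the integrals minus sums up to \<open>N\<close>. As the terms are nonnegative, so is the
  limit; this gives the signs of \<open>gauss_defect\<close> and of \<open>(-1)^m psi_bar m\<close>.
\<close>
lemma euler_defect_eqI:
  assumes anti: "\<And>u u'. 0 < u \<Longrightarrow> u \<le> u' \<Longrightarrow> f u' \<le> f u" and cont: "continuous_on {0..} f"
    and lim: "(\<lambda>N. (\<integral>u. indicator {0..real N} u * f u \<partial>lborel) - (\<Sum>n<N. f (real (Suc n)))) \<longlonglongrightarrow> L"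
  shows "euler_defect f = ennreal L" and "L \<ge> 0"
proof -
  have int: "integrable lborel (\<lambda>u. indicator {a<..b} u * f u)" if "a \<ge> 0" for a b
  proof -
    have "set_integrable lborel {a..b} f"
      by (rule borel_integrable_atLeastAtMost') (rule continuous_on_subset[OF cont], use that in auto)
    hence "set_integrable lborel {a<..b} f" by (rule set_integrable_subset) auto
    thus ?thesis by (simp add: set_integrable_def)
  qed
  define I where "I n = (\<integral>u. indicator {real n<..real (Suc n)} u * f u \<partial>lborel)" for n
  have partial: "(\<integral>u. indicator {0..real N} u * f u \<partial>lborel) = (\<Sum>n<N. I n)" for N
  proof -
    have "(\<integral>u. indicator {0..real N} u * f u \<partial>lborel) = (\<integral>u. indicator {0<..real N} u * f u \<partial>lborel)"
    proof (rule integral_cong_AE)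
      have "set_integrable lborel {0..real N} f"
        by (rule borel_integrable_atLeastAtMost') (rule continuous_on_subset[OF cont], auto)
      thus "(\<lambda>u. indicator {0..real N} u * f u) \<in> borel_measurable lborel"
        unfolding set_integrable_def by (auto dest: borel_measurable_integrable)
      show "(\<lambda>u. indicator {0<..real N} u * f u) \<in> borel_measurable lborel"
        by (rule borel_measurable_integrable) (rule int, simp)
    qed (rule eventually_mono[OF AE_lborel_singleton[of 0]], auto simp: indicator_def)
    also have "\<dots> = (\<Sum>n<N. I n)"
    proof (induction N)
      case (Suc N)
      have "(\<integral>u. indicator {0<..real (Suc N)} u * f u \<partial>lborel) =
        (\<integral>u. indicator {0<..real N} u * f u + indicator {real N<..real (Suc N)} u * f u \<partial>lborel)"
        by (intro Bochner_Integration.integral_cong) (auto simp: indicator_def)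
      also have "\<dots> = (\<integral>u. indicator {0<..real N} u * f u \<partial>lborel) + (\<integral>u. indicator {real N<..real (Suc N)} u * f u \<partial>lborel)"
        by (rule Bochner_Integration.integral_add) (rule int, simp)+
      also have "\<dots> = (\<Sum>n<N. I n) + I N"
        unfolding Suc.IH I_def ..
      finally show ?case by simp
    qed simp
    finally show ?thesis .
  qed
  have term_eq: "(\<integral>\<^sup>+u. indicator {real n<..real (Suc n)} u * ennreal (f u - f (real (Suc n))) \<partial>lborel) = ennreal (I n - f (real (Suc n)))"
    and nonneg: "0 \<le> I n - f (real (Suc n))" for n
  proof -
    let ?h = "\<lambda>u. indicator {real n<..real (Suc n)} u * f u - indicator {real n<..real (Suc n)} u * f (real (Suc n))"
    have h: "has_bochner_integral lborel ?h (I n - f (real (Suc n)))"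
    proof (rule has_bochner_integral_diff)
      show "has_bochner_integral lborel (\<lambda>u. indicator {real n<..real (Suc n)} u * f u) (I n)"
        unfolding I_def by (rule has_bochner_integral_integrable) (rule int, simp)
      show "has_bochner_integral lborel (\<lambda>u. indicator {real n<..real (Suc n)} u * f (real (Suc n))) (f (real (Suc n)))"
        by (simp add: has_bochner_integral_iff)
    qed
    have h_nonneg: "?h u \<ge> 0" for u using anti[of u "real (Suc n)"] by (auto simp: indicator_def)
    have "(\<integral>\<^sup>+u. indicator {real n<..real (Suc n)} u * ennreal (f u - f (real (Suc n))) \<partial>lborel) = (\<integral>\<^sup>+u. ennreal (?h u) \<partial>lborel)"
      by (intro nn_integral_cong) (auto simp: indicator_def)
    also have "\<dots> = ennreal (\<integral>u. ?h u \<partial>lborel)"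
      using h h_nonneg by (intro nn_integral_eq_integral) (auto simp: has_bochner_integral_iff)
    finally show "(\<integral>\<^sup>+u. indicator {real n<..real (Suc n)} u * ennreal (f u - f (real (Suc n))) \<partial>lborel) = ennreal (I n - f (real (Suc n)))"
      using h by (simp add: has_bochner_integral_iff)
    have "0 \<le> (\<integral>u. ?h u \<partial>lborel)" by (rule Bochner_Integration.integral_nonneg) (rule h_nonneg)
    thus "0 \<le> I n - f (real (Suc n))" using h by (simp add: has_bochner_integral_iff)
  qed
  have "(\<lambda>n. I n - f (real (Suc n))) sums L"
    using lim unfolding partial sums_def by (simp add: sum_subtractf)
  thus "euler_defect f = ennreal L" and "L \<ge> 0"
    unfolding euler_defect_def term_eq using suminf_ennreal_eq[OF nonneg] sums_le[OF nonneg sums_zero] by auto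
qed

lemma euler_defect_cmult:
  assumes "c \<ge> 0" and [measurable]: "f \<in> borel_measurable borel"
  shows "euler_defect (\<lambda>u. c * f u) = ennreal c * euler_defect f"
proof -
  have "(\<integral>\<^sup>+u. indicator {real n<..real (Suc n)} u * ennreal (c * f u - c * f (real (Suc n))) \<partial>lborel)
      = ennreal c * (\<integral>\<^sup>+u. indicator {real n<..real (Suc n)} u * ennreal (f u - f (real (Suc n))) \<partial>lborel)" for n
    using assms(1) by (subst nn_integral_cmult[symmetric])
      (auto simp: right_diff_distrib[symmetric] ennreal_mult' mult_ac intro!: nn_integral_cong)
  thus ?thesis unfolding euler_defect_def by (simp only: ennreal_suminf_cmult)
qed

text \<open>
  The defect commutes with integration in a parameter \<open>t\<close>, by Tonelli's theorem. What matters for the applications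
  is that the right-hand side depends on \<open>P\<close> only through the integrals over \<open>t\<close> for fixed \<open>u\<close>.
\<close>
lemma
  fixes P :: "real \<Rightarrow> real \<Rightarrow> real"
  assumes meas: "(\<lambda>p. P (fst p) (snd p)) \<in> borel_measurable (borel \<Otimes>\<^sub>M borel)"
  shows measurable_euler_defect: "(\<lambda>t. euler_defect (P t)) \<in> borel_measurable borel"
    and nn_integral_euler_defect: "\<lbrakk>\<And>t u. 0 < u \<Longrightarrow> P t u \<ge> 0; \<And>t u u'. 0 < u \<Longrightarrow> u \<le> u' \<Longrightarrow> P t u' \<le> P t u;
        \<And>u. u > 0 \<Longrightarrow> (\<integral>\<^sup>+t. ennreal (P t u) \<partial>lborel) < \<infinity>\<rbrakk> \<Longrightarrow>
       (\<integral>\<^sup>+t. euler_defect (P t) \<partial>lborel) = 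
       (\<Sum>n. \<integral>\<^sup>+u. indicator {real n<..real (Suc n)} u * ((\<integral>\<^sup>+t. ennreal (P t u) \<partial>lborel) - (\<integral>\<^sup>+t. ennreal (P t (real (Suc n))) \<partial>lborel)) \<partial>lborel)"
proof -
  have P2 [measurable]: "(\<lambda>x. P (f x) (g x)) \<in> borel_measurable M"
    if "f \<in> borel_measurable M" "g \<in> borel_measurable M" for f g and M :: "(real \<times> real) measure"
    using measurable_compose[OF measurable_Pair[OF that] meas] by simp
  have P1 [measurable]: "(\<lambda>x. P (f x) (g x)) \<in> borel_measurable M"
    if "f \<in> borel_measurable M" "g \<in> borel_measurable M" for f g and M :: "real measure"
    using measurable_compose[OF measurable_Pair[OF that] meas] by simp
  show "(\<lambda>t. euler_defect (P t)) \<in> borel_measurable borel"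
    unfolding euler_defect_def by measurable
  assume nonneg: "\<And>t u. 0 < u \<Longrightarrow> P t u \<ge> 0" and anti: "\<And>t u u'. 0 < u \<Longrightarrow> u \<le> u' \<Longrightarrow> P t u' \<le> P t u"
    and fin: "\<And>u. u > 0 \<Longrightarrow> (\<integral>\<^sup>+t. ennreal (P t u) \<partial>lborel) < \<infinity>"
  have "(\<integral>\<^sup>+t. euler_defect (P t) \<partial>lborel) = 
     (\<Sum>n. \<integral>\<^sup>+t. \<integral>\<^sup>+u. indicator {real n<..real (Suc n)} u * ennreal (P t u - P t (real (Suc n))) \<partial>lborel \<partial>lborel)"
    unfolding euler_defect_def by (rule nn_integral_suminf) measurable
  moreover have "(\<integral>\<^sup>+t. \<integral>\<^sup>+u. indicator {real n<..real (Suc n)} u * ennreal (P t u - P t (real (Suc n))) \<partial>lborel \<partial>lborel)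
    = (\<integral>\<^sup>+u. indicator {real n<..real (Suc n)} u * ((\<integral>\<^sup>+t. ennreal (P t u) \<partial>lborel) - (\<integral>\<^sup>+t. ennreal (P t (real (Suc n))) \<partial>lborel)) \<partial>lborel)" for n
  proof -
    have "(\<integral>\<^sup>+t. \<integral>\<^sup>+u. indicator {real n<..real (Suc n)} u * ennreal (P t u - P t (real (Suc n))) \<partial>lborel \<partial>lborel)
      = (\<integral>\<^sup>+u. \<integral>\<^sup>+t. indicator {real n<..real (Suc n)} u * ennreal (P t u - P t (real (Suc n))) \<partial>lborel \<partial>lborel)"
      by (rule lborel_pair.Fubini'[symmetric]) measurable
    also have "\<dots> = (\<integral>\<^sup>+u. indicator {real n<..real (Suc n)} u * ((\<integral>\<^sup>+t. ennreal (P t u) \<partial>lborel) - (\<integral>\<^sup>+t. ennreal (P t (real (Suc n))) \<partial>lborel)) \<partial>lborel)"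
    proof (rule nn_integral_cong)
      fix u :: real
      show "(\<integral>\<^sup>+t. indicator {real n<..real (Suc n)} u * ennreal (P t u - P t (real (Suc n))) \<partial>lborel)
        = indicator {real n<..real (Suc n)} u * ((\<integral>\<^sup>+t. ennreal (P t u) \<partial>lborel) - (\<integral>\<^sup>+t. ennreal (P t (real (Suc n))) \<partial>lborel))"
      proof (cases "u \<in> {real n<..real (Suc n)}")
        case True
        hence u: "0 < u" "u \<le> real (Suc n)" by auto
        have "(\<integral>\<^sup>+t. ennreal (P t u - P t (real (Suc n))) \<partial>lborel) = (\<integral>\<^sup>+t. ennreal (P t u) - ennreal (P t (real (Suc n))) \<partial>lborel)"
          by (intro nn_integral_cong) (simp add: ennreal_minus nonneg)
        also have "\<dots> = (\<integral>\<^sup>+t. ennreal (P t u) \<partial>lborel) - (\<integral>\<^sup>+t. ennreal (P t (real (Suc n))) \<partial>lborel)"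
          using fin[of "real (Suc n)"] anti[OF u] by (intro nn_integral_diff) (auto intro!: AE_I2 ennreal_leI)
        finally show ?thesis using True by simp
      qed simp
    qed
    finally show ?thesis .
  qed
  ultimately show "(\<integral>\<^sup>+t. euler_defect (P t) \<partial>lborel) = 
       (\<Sum>n. \<integral>\<^sup>+u. indicator {real n<..real (Suc n)} u * ((\<integral>\<^sup>+t. ennreal (P t u) \<partial>lborel) - (\<integral>\<^sup>+t. ennreal (P t (real (Suc n))) \<partial>lborel)) \<partial>lborel)" by (simp only:)
qed

lemma gaussian_halfline:
  assumes "v > 0"
  shows "has_bochner_integral lborel (\<lambda>u. indicator {0<..} u * exp (- pi * u\<^sup>2 * v\<^sup>2)) (1 / (2 * v))"
proof -
  let ?f = "\<lambda>u. exp (- pi * u\<^sup>2 * v\<^sup>2)"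
  have int: "integrable lborel ?f" by (rule gaussian_fourier(1)[OF assms])
  have pos: "integrable lborel (\<lambda>u. indicator {0<..} u * ?f u)"
    using integrable_mult_indicator[of "{0<..}" lborel ?f] int by simp
  have neg: "(\<integral>u. indicator {..<0} u * ?f u \<partial>lborel) = (\<integral>u. indicator {0<..} u * ?f u \<partial>lborel)"
    using lborel_integral_real_affine[of "-1" "\<lambda>u. indicator {..<0} u * ?f u" 0] by (simp add: indicator_def)
  have neg_int: "integrable lborel (\<lambda>u. indicator {..<0} u * ?f u)"
    using integrable_mult_indicator[of "{..<0}" lborel ?f] int by simp
  have "1 / v = (\<integral>u. ?f u \<partial>lborel)" using gaussian_fourier(2)[OF assms, of 0] by simp
  also have "\<dots> = (\<integral>u. indicator {0<..} u * ?f u + indicator {..<0} u * ?f u \<partial>lborel)"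
    by (intro integral_cong_AE eventually_mono[OF AE_lborel_singleton[of 0]]) (auto simp: indicator_def)
  also have "\<dots> = 2 * (\<integral>u. indicator {0<..} u * ?f u \<partial>lborel)"
    using pos neg neg_int by simp
  finally show ?thesis using pos by (simp add: has_bochner_integral_iff)
qed

lemma euler_defect_gaussian:
  assumes v: "v > 0"
  shows "euler_defect (\<lambda>u. exp (- pi * u\<^sup>2 * v\<^sup>2)) = ennreal (gauss_defect v)" and "gauss_defect v \<ge> 0"
proof -
  let ?f = "\<lambda>u. exp (- pi * u\<^sup>2 * v\<^sup>2)"
  have anti: "?f u' \<le> ?f u" if "0 < u" "u \<le> u'" for u u'
  proof -
    have "u\<^sup>2 \<le> u'\<^sup>2" using that by (intro power_mono) auto
    hence "pi * v\<^sup>2 * u\<^sup>2 \<le> pi * v\<^sup>2 * u'\<^sup>2" by (intro mult_left_mono) auto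
    thus ?thesis by (simp add: mult_ac)
  qed
  have cont: "continuous_on {0..} ?f" by (intro continuous_intros)
  have "(\<lambda>N. \<integral>u. indicator {0..real N} u * ?f u \<partial>lborel) \<longlonglongrightarrow> (\<integral>u. indicator {0<..} u * ?f u \<partial>lborel)"
  proof (rule integral_dominated_convergence[where w = ?f])
    show "integrable lborel ?f" by (rule gaussian_fourier(1)[OF v])
    show "AE u in lborel. (\<lambda>N. indicator {0..real N} u * ?f u) \<longlonglongrightarrow> indicator {0<..} u * ?f u"
    proof (rule eventually_mono[OF AE_lborel_singleton[of 0]])
      fix u :: real assume "u \<noteq> 0"
      obtain N0 :: nat where "\<bar>u\<bar> < real N0" using reals_Archimedean2 by blast
      hence "eventually (\<lambda>N. indicator {0..real N} u * ?f u = indicator {0<..} u * ?f u) sequentially"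
        using \<open>u \<noteq> 0\<close> by (intro eventually_sequentiallyI[of N0]) (auto simp: indicator_def)
      thus "(\<lambda>N. indicator {0..real N} u * ?f u) \<longlonglongrightarrow> indicator {0<..} u * ?f u"
        by (rule tendsto_eventually)
    qed
  qed (auto simp: indicator_def)
  moreover have "(\<lambda>n. ?f (real (Suc n))) sums gauss_sum v"
    unfolding gauss_sum_def using v by (intro summable_sums summable_gauss_sum) auto
  ultimately have lim: "(\<lambda>N. (\<integral>u. indicator {0..real N} u * ?f u \<partial>lborel) - (\<Sum>n<N. ?f (real (Suc n)))) \<longlonglongrightarrow> gauss_defect v"
    unfolding gauss_defect_def sums_def has_bochner_integral_integral_eq[OF gaussian_halfline[OF v]]
    by (rule tendsto_diff)
  show "euler_defect ?f = ennreal (gauss_defect v)" and "gauss_defect v \<ge> 0"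
    using euler_defect_eqI[OF anti cont lim] by auto
qed

lemma psi_bar_closed_form:
  assumes "t > 0"
  shows "psi_bar m t = Polygamma m (t + 1) - (case m of 0 \<Rightarrow> ln t | Suc k \<Rightarrow> (-1) ^ k * fact k / t ^ Suc k)"
  using assms
proof (induction m arbitrary: t)
  case 0
  show ?case by (simp add: psi_bar_def)
next
  case (Suc m)
  let ?L = "\<lambda>t :: real. case m of 0 \<Rightarrow> ln t | Suc k \<Rightarrow> (-1) ^ k * fact k / t ^ Suc k"
  have "psi_bar (Suc m) t = deriv (psi_bar m) t" by (simp add: psi_bar_def)
  also have "\<dots> = deriv (\<lambda>t. Polygamma m (t + 1) - ?L t) t"
  proof (rule deriv_cong_ev)
    have "eventually (\<lambda>x. x \<in> {0<..}) (nhds t)" using Suc.prems by (intro eventually_nhds_in_open) auto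
    thus "\<forall>\<^sub>F x in nhds t. psi_bar m x = Polygamma m (x + 1) - ?L x"
      by eventually_elim (auto intro: Suc.IH)
  qed simp
  also have "\<dots> = Polygamma (Suc m) (t + 1) - (-1) ^ m * fact m / t ^ Suc m"
  proof (rule DERIV_imp_deriv, rule DERIV_diff)
    have "t + 1 \<notin> \<int>\<^sub>\<le>\<^sub>0" using Suc.prems by (auto elim!: nonpos_Ints_cases)
    thus "((\<lambda>t. Polygamma m (t + 1)) has_field_derivative Polygamma (Suc m) (t + 1)) (at t)"
      by (auto intro!: derivative_eq_intros)
    show "(?L has_field_derivative (-1) ^ m * fact m / t ^ Suc m) (at t)"
    proof (cases m)
      case 0
      thus ?thesis using Suc.prems by (auto intro!: derivative_eq_intros simp: field_simps)
    next
      case (Suc k)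
      have "((\<lambda>t. inverse (t ^ Suc k)) has_field_derivative (- (inverse (t ^ Suc k) * (real (Suc k) * t ^ k) * inverse (t ^ Suc k)))) (at t)"
        using \<open>t > 0\<close> DERIV_pow[of "Suc k" t] by (intro DERIV_inverse') auto
      from DERIV_cmult[OF this, of "(-1) ^ k * fact k"] have "((\<lambda>t. (-1) ^ k * fact k / t ^ Suc k) has_field_derivative 
        ((-1) ^ k * fact k * (- (inverse (t ^ Suc k) * (real (Suc k) * t ^ k) * inverse (t ^ Suc k))))) (at t)"
        by (simp add: divide_inverse)
      also have "(-1) ^ k * fact k * (- (inverse (t ^ Suc k) * (real (Suc k) * t ^ k) * inverse (t ^ Suc k))) = (-1) ^ Suc k * fact (Suc k) / t ^ Suc (Suc k)"
        using \<open>t > 0\<close> by (simp add: field_simps)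
      finally show ?thesis by (simp add: Suc)
    qed
  qed
  finally show ?case by simp
qed

text \<open>
  The partial integrals are elementary. For \<open>m = 0\<close> they grow like \<open>ln N\<close>, and the limit is the one that defines the
  digamma function; for \<open>m > 0\<close> integral and sum converge separately, the sum to a value of the polygamma function.
\<close>
lemma euler_defect_reciprocal_power:
  assumes t: "t > 0"
  shows "euler_defect (\<lambda>u. fact m * t ^ m / (u + t) ^ Suc m) = ennreal ((-1) ^ m * t ^ m * psi_bar m t)"
    and "(-1) ^ m * t ^ m * psi_bar m t \<ge> 0"
proof -
  let ?f = "\<lambda>u. fact m * t ^ m / (u + t) ^ Suc m"
  have anti: "?f u' \<le> ?f u" if "0 < u" "u \<le> u'" for u u'
    using that t by (intro divide_left_mono power_mono mult_pos_pos) auto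
  have cont: "continuous_on {0..} ?f" using t by (intro continuous_intros) auto
  have FTC: "(\<integral>u. indicator {0..real N} u * ?f u \<partial>lborel) = F (real N) - F 0"
    if "\<And>u. u \<ge> 0 \<Longrightarrow> (F has_field_derivative ?f u) (at u)" for F N
  proof -
    have "has_bochner_integral lborel (\<lambda>u. ?f u * indicator {0..real N} u) (F (real N) - F 0)"
      using that t by (intro has_bochner_integral_FTC_Icc_real) auto
    thus ?thesis by (simp only: has_bochner_integral_iff mult.commute)
  qed
  have lim: "(\<lambda>N. (\<integral>u. indicator {0..real N} u * ?f u \<partial>lborel) - (\<Sum>n<N. ?f (real (Suc n)))) \<longlonglongrightarrow> (-1) ^ m * t ^ m * psi_bar m t"
  proof (cases m)
    case 0
    have I: "(\<integral>u. indicator {0..real N} u * ?f u \<partial>lborel) = ln (real N + t) - ln (0 + t)" for N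
      using t 0 by (intro FTC) (auto intro!: derivative_eq_intros)
    have "(\<lambda>N. ln (real N + t) - ln (real N)) \<longlonglongrightarrow> 0" by real_asymp
    from tendsto_add[OF this tendsto_diff[OF Digamma_LIMSEQ[of "t + 1"] tendsto_const[of "ln t"]]] t
    have lim: "(\<lambda>N. (ln (real N + t) - ln (real N)) + ((of_real (ln (real N)) - (\<Sum>n<N. inverse (t + 1 + of_nat n))) - ln t))
        \<longlonglongrightarrow> (-1) ^ m * t ^ m * psi_bar m t"
      by (simp add: psi_bar_closed_form 0)
    have "(\<integral>u. indicator {0..real N} u * ?f u \<partial>lborel) - (\<Sum>n<N. ?f (real (Suc n))) =
      (ln (real N + t) - ln (real N)) + ((of_real (ln (real N)) - (\<Sum>n<N. inverse (t + 1 + of_nat n))) - ln t)" for N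
      unfolding I by (simp add: 0 divide_inverse add_ac)
    with lim show ?thesis by (simp only:)
  next
    case (Suc k)
    let ?F = "\<lambda>u. - fact k * t ^ m / (u + t) ^ m"
    have I: "(\<integral>u. indicator {0..real N} u * ?f u \<partial>lborel) = ?F (real N) - ?F 0" for N
    proof (rule FTC)
      fix u :: real assume u: "u \<ge> 0"
      have "((\<lambda>u. (u + t) ^ m) has_field_derivative real m * (u + t) ^ k) (at u)"
      proof -
        have "((\<lambda>u. u + t) has_field_derivative 1) (at u)" by (auto intro!: derivative_eq_intros)
        from DERIV_power[OF this, of m] show ?thesis by (simp add: Suc)
      qed
      from DERIV_inverse'[OF this] have "((\<lambda>u. inverse ((u + t) ^ m)) has_field_derivative
          - (inverse ((u + t) ^ m) * (real m * (u + t) ^ k) * inverse ((u + t) ^ m))) (at u)"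
        using u t by simp
      from DERIV_cmult[OF this, of "- fact k * t ^ m"]
      have "(?F has_field_derivative - fact k * t ^ m * - (inverse ((u + t) ^ m) * (real m * (u + t) ^ k) * inverse ((u + t) ^ m))) (at u)"
        by (simp add: divide_inverse)
      also have "- fact k * t ^ m * - (inverse ((u + t) ^ m) * (real m * (u + t) ^ k) * inverse ((u + t) ^ m)) = ?f u"
      proof -
        define w where "w = u + t"
        have "w > 0" using u t by (simp add: w_def)
        thus ?thesis unfolding w_def[symmetric] Suc by (simp add: field_simps)
      qed
      finally show "(?F has_field_derivative ?f u) (at u)" .
    qed
    have "filterlim (\<lambda>N. (real N + t) ^ m) at_top sequentially"
      using Suc by (intro filterlim_pow_at_top filterlim_tendsto_add_at_top[OF tendsto_const, of _ _ t, unfolded add.commute[of t]] filterlim_real_sequentially) auto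
    hence F_lim: "(\<lambda>N. ?F (real N)) \<longlonglongrightarrow> 0"
      by (intro tendsto_divide_0[OF tendsto_const] filterlim_at_top_imp_at_infinity)
    have "(\<lambda>k. inverse ((t + 1 + real k) ^ Suc m)) sums ((-1) ^ Suc m * Polygamma m (t + 1) / fact m)"
      using Polygamma_LIMSEQ[of "t + 1" m] t Suc by simp
    from sums_mult[OF this, of "fact m * t ^ m"]
    have "(\<lambda>n. fact m * t ^ m * inverse ((t + 1 + real n) ^ Suc m)) sums (fact m * t ^ m * ((-1) ^ Suc m * Polygamma m (t + 1) / fact m))" .
    moreover have "fact m * t ^ m * ((-1) ^ Suc m * Polygamma m (t + 1) / fact m) = (-1) ^ Suc m * t ^ m * Polygamma m (t + 1)"
      by simp
    moreover have "(\<lambda>n. ?f (real (Suc n))) = (\<lambda>n. fact m * t ^ m * inverse ((t + 1 + real n) ^ Suc m))"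
      by (simp add: fun_eq_iff divide_inverse add_ac)
    ultimately have "(\<lambda>n. ?f (real (Suc n))) sums ((-1) ^ Suc m * t ^ m * Polygamma m (t + 1))"
      by (simp only:)
    hence "(\<lambda>N. (\<integral>u. indicator {0..real N} u * ?f u \<partial>lborel) - (\<Sum>n<N. ?f (real (Suc n)))) \<longlonglongrightarrow>
        0 - ?F 0 - (-1) ^ Suc m * t ^ m * Polygamma m (t + 1)"
      unfolding I sums_def using F_lim by (intro tendsto_diff tendsto_const)
    also have "0 - ?F 0 - (-1) ^ Suc m * t ^ m * Polygamma m (t + 1) = (-1) ^ m * t ^ m * psi_bar m t"
    proof -
      have "(-1) ^ m * t ^ m * ((-1) ^ k * fact k / t ^ Suc k) = (- fact k :: real)"
        using t by (simp add: Suc power_add[symmetric] flip: mult_2)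
      thus ?thesis using t unfolding psi_bar_closed_form[OF t] right_diff_distrib by (simp add: Suc)
    qed
    finally show ?thesis .
  qed
  show "euler_defect ?f = ennreal ((-1) ^ m * t ^ m * psi_bar m t)" and "(-1) ^ m * t ^ m * psi_bar m t \<ge> 0"
    using euler_defect_eqI[OF anti cont lim] by auto
qed

text \<open>
  Both integrands are defects of kernels \<open>P\<close> and \<open>Q\<close>. For fixed \<open>u > 0\<close> the substitution \<open>t = u v / b\<close> shows that \<open>P\<close> and
  \<open>Q\<close> have the same integral; hence so do the defects.
\<close>
lemma nn_integral_psi_bar_gaussian:
  assumes b: "b > 0"
  shows "(\<lambda>t. indicator {0<..} t * ((-1) ^ m * t ^ m * psi_bar m t * exp (- pi * t\<^sup>2 * b\<^sup>2))) \<in> borel_measurable borel"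
    and "(\<integral>\<^sup>+t. ennreal (indicator {0<..} t * ((-1) ^ m * t ^ m * psi_bar m t * exp (- pi * t\<^sup>2 * b\<^sup>2))) \<partial>lborel) =
     (\<integral>\<^sup>+v. ennreal (indicator {0<..} v * (fact m * v ^ m / (b + v) ^ Suc m * gauss_defect v)) \<partial>lborel)"
proof -
  define P :: "real \<Rightarrow> real \<Rightarrow> real" where
    "P t u = indicator {0<..} t * exp (- pi * t\<^sup>2 * b\<^sup>2) * (fact m * t ^ m / (u + t) ^ Suc m)" for t u
  define Q :: "real \<Rightarrow> real \<Rightarrow> real" where
    "Q v u = indicator {0<..} v * (fact m * v ^ m / (b + v) ^ Suc m) * exp (- pi * u\<^sup>2 * v\<^sup>2)" for v u
  have P_meas: "(\<lambda>p. P (fst p) (snd p)) \<in> borel_measurable (borel \<Otimes>\<^sub>M borel)"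
    and Q_meas: "(\<lambda>p. Q (fst p) (snd p)) \<in> borel_measurable (borel \<Otimes>\<^sub>M borel)"
    unfolding P_def Q_def by measurable
  have P_defect: "euler_defect (P t) = ennreal (indicator {0<..} t * ((-1) ^ m * t ^ m * psi_bar m t * exp (- pi * t\<^sup>2 * b\<^sup>2)))" for t
  proof (cases "t > 0")
    case True
    hence "euler_defect (P t) = ennreal (exp (- pi * t\<^sup>2 * b\<^sup>2)) * euler_defect (\<lambda>u. fact m * t ^ m / (u + t) ^ Suc m)"
      using euler_defect_cmult[of "exp (- pi * t\<^sup>2 * b\<^sup>2)" "\<lambda>u. fact m * t ^ m / (u + t) ^ Suc m"] by (simp add: P_def[abs_def])
    also have "\<dots> = ennreal (exp (- pi * t\<^sup>2 * b\<^sup>2) * ((-1) ^ m * t ^ m * psi_bar m t))"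
      unfolding euler_defect_reciprocal_power(1)[OF True] by (rule ennreal_mult'[symmetric]) simp
    finally show ?thesis using True by (simp add: mult_ac)
  qed (simp add: P_def[abs_def] euler_defect_def)
  have Q_defect: "euler_defect (Q v) = ennreal (indicator {0<..} v * (fact m * v ^ m / (b + v) ^ Suc m * gauss_defect v))" for v
  proof (cases "v > 0")
    case True
    have c: "fact m * v ^ m / (b + v) ^ Suc m \<ge> 0" using True b by auto
    have "euler_defect (Q v) = ennreal (fact m * v ^ m / (b + v) ^ Suc m) * euler_defect (\<lambda>u. exp (- pi * u\<^sup>2 * v\<^sup>2))"
      using True euler_defect_cmult[OF c, of "\<lambda>u. exp (- pi * u\<^sup>2 * v\<^sup>2)"] by (simp add: Q_def[abs_def])
    also have "\<dots> = ennreal (fact m * v ^ m / (b + v) ^ Suc m * gauss_defect v)"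
      unfolding euler_defect_gaussian(1)[OF True] by (rule ennreal_mult'[symmetric]) (rule c)
    finally show ?thesis using True by simp
  qed (simp add: Q_def[abs_def] euler_defect_def)
  have nonneg: "P t u \<ge> 0" "Q t u \<ge> 0" if "u > 0" for t u
    using that b by (auto simp: P_def Q_def indicator_def)
  have P_anti: "P t u' \<le> P t u" if "0 < u" "u \<le> u'" for t u u'
  proof (cases "t > 0")
    case True
    hence "fact m * t ^ m / (u' + t) ^ Suc m \<le> fact m * t ^ m / (u + t) ^ Suc m"
      using that by (intro divide_left_mono power_mono mult_pos_pos) auto
    thus ?thesis unfolding P_def by (rule mult_left_mono) simp
  qed (simp add: P_def)
  have Q_anti: "Q t u' \<le> Q t u" if "0 < u" "u \<le> u'" for t u u'
  proof -
    have "u\<^sup>2 \<le> u'\<^sup>2" using that by (intro power_mono) auto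
    hence "pi * t\<^sup>2 * u\<^sup>2 \<le> pi * t\<^sup>2 * u'\<^sup>2" by (intro mult_left_mono) auto
    hence "exp (- pi * u'\<^sup>2 * t\<^sup>2) \<le> exp (- pi * u\<^sup>2 * t\<^sup>2)" by (simp add: mult_ac)
    thus ?thesis unfolding Q_def using b by (intro mult_left_mono) (auto simp: indicator_def)
  qed
  have scaling: "(\<integral>\<^sup>+t. ennreal (P t u) \<partial>lborel) = (\<integral>\<^sup>+v. ennreal (Q v u) \<partial>lborel)" if u: "u > 0" for u
  proof -
    have [measurable]: "(\<lambda>t. P t u) \<in> borel_measurable borel" unfolding P_def by measurable
    have "(\<integral>\<^sup>+t. ennreal (P t u) \<partial>lborel) = ennreal \<bar>u / b\<bar> * (\<integral>\<^sup>+v. ennreal (P (0 + u / b * v) u) \<partial>lborel)"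
      using u b by (intro nn_integral_real_affine) auto
    also have "\<dots> = (\<integral>\<^sup>+v. ennreal \<bar>u / b\<bar> * ennreal (P (0 + u / b * v) u) \<partial>lborel)"
      by (rule nn_integral_cmult[symmetric]) measurable
    also have "\<dots> = (\<integral>\<^sup>+v. ennreal (Q v u) \<partial>lborel)"
    proof (rule nn_integral_cong)
      fix v :: real
      have "u / b * P (0 + u / b * v) u = Q v u"
      proof (cases "v > 0")
        case True
        have e: "- pi * (u / b * v)\<^sup>2 * b\<^sup>2 = - pi * u\<^sup>2 * v\<^sup>2"
          using b by (simp add: power_mult_distrib power_divide)
        have "u + u / b * v = u / b * (b + v)" using b by (simp add: field_simps)
        hence quot: "u / b * (fact m * (u / b * v) ^ m / (u + u / b * v) ^ Suc m) = fact m * v ^ m / (b + v) ^ Suc m"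
          using u b True by (simp only: power_mult_distrib power_Suc) (simp add: divide_simps)
        have "u / b * v > 0" using True u b by simp
        hence "P (0 + u / b * v) u = exp (- pi * u\<^sup>2 * v\<^sup>2) * (fact m * (u / b * v) ^ m / (u + u / b * v) ^ Suc m)"
          unfolding P_def add_0 e by simp
        hence "u / b * P (0 + u / b * v) u = exp (- pi * u\<^sup>2 * v\<^sup>2) * (fact m * v ^ m / (b + v) ^ Suc m)"
          unfolding quot[symmetric] by (simp only: mult.left_commute)
        thus ?thesis using True by (simp add: Q_def mult_ac)
      next
        case False
        moreover from this have "\<not> u / b * v > 0" using u b by (simp add: zero_less_mult_iff zero_less_divide_iff)
        ultimately show ?thesis by (simp add: P_def Q_def)
      qed
      moreover have "\<bar>u / b\<bar> = u / b" using u b by simp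
      ultimately show "ennreal \<bar>u / b\<bar> * ennreal (P (0 + u / b * v) u) = ennreal (Q v u)"
        using u b by (simp add: ennreal_mult'[symmetric])
    qed
    finally show ?thesis .
  qed
  have Q_fin: "(\<integral>\<^sup>+v. ennreal (Q v u) \<partial>lborel) < \<infinity>" if u: "u > 0" for u
  proof -
    have "(\<integral>\<^sup>+v. ennreal (Q v u) \<partial>lborel) \<le> (\<integral>\<^sup>+v. ennreal (fact m / b * exp (- pi * v\<^sup>2 * u\<^sup>2)) \<partial>lborel)"
    proof (intro nn_integral_mono ennreal_leI)
      fix v :: real
      show "Q v u \<le> fact m / b * exp (- pi * v\<^sup>2 * u\<^sup>2)"
      proof (cases "v > 0")
        case True
        have "fact m * v ^ m / (b + v) ^ Suc m = fact m / (b + v) * (v / (b + v)) ^ m"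
          by (simp add: power_divide)
        also have "\<dots> \<le> fact m / b * 1 ^ m"
          using True b by (intro mult_mono power_mono divide_left_mono) auto
        finally have "fact m * v ^ m / (b + v) ^ Suc m \<le> fact m / b" by simp
        from mult_right_mono[OF this, of "exp (- pi * v\<^sup>2 * u\<^sup>2)"] show ?thesis
          using True by (simp add: Q_def mult_ac)
      qed (use b in \<open>simp add: Q_def\<close>)
    qed
    also have "\<dots> < \<infinity>"
    proof -
      have "integrable lborel (\<lambda>v. fact m / b * exp (- pi * v\<^sup>2 * u\<^sup>2))" using gaussian_fourier(1)[OF u] by simp
      thus ?thesis using b by (subst nn_integral_eq_integral) (auto intro!: AE_I2)
    qed
    finally show ?thesis .
  qed
  have "(\<lambda>t. enn2real (euler_defect (P t))) \<in> borel_measurable borel"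
    using measurable_euler_defect[OF P_meas] by measurable
  also have "(\<lambda>t. enn2real (euler_defect (P t))) = (\<lambda>t. indicator {0<..} t * ((-1) ^ m * t ^ m * psi_bar m t * exp (- pi * t\<^sup>2 * b\<^sup>2)))"
    unfolding P_defect using euler_defect_reciprocal_power(2)[of _ m] by (auto simp: fun_eq_iff indicator_def)
  finally show "(\<lambda>t. indicator {0<..} t * ((-1) ^ m * t ^ m * psi_bar m t * exp (- pi * t\<^sup>2 * b\<^sup>2))) \<in> borel_measurable borel" .
  have "(\<integral>\<^sup>+t. euler_defect (P t) \<partial>lborel) = (\<integral>\<^sup>+v. euler_defect (Q v) \<partial>lborel)"
  proof -
    have "(\<integral>\<^sup>+t. euler_defect (P t) \<partial>lborel) = 
       (\<Sum>n. \<integral>\<^sup>+u. indicator {real n<..real (Suc n)} u * ((\<integral>\<^sup>+t. ennreal (P t u) \<partial>lborel) - (\<integral>\<^sup>+t. ennreal (P t (real (Suc n))) \<partial>lborel)) \<partial>lborel)"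
      using nonneg P_anti Q_fin scaling by (intro nn_integral_euler_defect P_meas) auto
    also have "\<dots> = (\<Sum>n. \<integral>\<^sup>+u. indicator {real n<..real (Suc n)} u * ((\<integral>\<^sup>+v. ennreal (Q v u) \<partial>lborel) - (\<integral>\<^sup>+v. ennreal (Q v (real (Suc n))) \<partial>lborel)) \<partial>lborel)"
      by (intro suminf_cong nn_integral_cong) (auto simp: indicator_def scaling)
    also have "\<dots> = (\<integral>\<^sup>+v. euler_defect (Q v) \<partial>lborel)"
      using nonneg Q_anti Q_fin by (intro nn_integral_euler_defect[symmetric] Q_meas) auto
    finally show ?thesis .
  qed
  thus "(\<integral>\<^sup>+t. ennreal (indicator {0<..} t * ((-1) ^ m * t ^ m * psi_bar m t * exp (- pi * t\<^sup>2 * b\<^sup>2))) \<partial>lborel) =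
     (\<integral>\<^sup>+v. ennreal (indicator {0<..} v * (fact m * v ^ m / (b + v) ^ Suc m * gauss_defect v)) \<partial>lborel)"
    unfolding P_defect Q_defect .
qed

section \<open>Evaluation of both sides\<close>

definition sech_kernel :: "nat \<Rightarrow> real \<Rightarrow> real" where
  "sech_kernel m v = 2 * fact m * exp (v / 2) / (1 + exp v) ^ Suc m"

lemma sech_kernel_measurable [measurable]: "sech_kernel m \<in> borel_measurable borel"
  unfolding sech_kernel_def[abs_def] by measurable

lemma sech_kernel_bounded: "norm (sech_kernel m v) \<le> 2 * fact m"
proof -
  have pos: "1 + exp v > 0" by (simp add: add_pos_pos)
  have "exp (v / 2) \<le> 1 + exp v"
    by (cases "v \<ge> 0") (auto intro: order_trans[of _ "exp v"] order_trans[of _ 1] add_increasing add_increasing2)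
  also have "\<dots> = (1 + exp v) ^ 1" by simp
  also have "\<dots> \<le> (1 + exp v) ^ Suc m" by (rule power_increasing) auto
  finally have "exp (v / 2) / (1 + exp v) ^ Suc m \<le> 1" using pos by (simp add: divide_le_eq del: power_Suc)
  from mult_left_mono[OF this, of "2 * fact m"] show ?thesis
    using pos by (simp add: sech_kernel_def abs_mult abs_divide)
qed

lemma integrable_xi_kernel: "integrable lborel (\<lambda>u. complex_of_real (xi_kernel u))" "integrable lborel xi_kernel"
proof -
  show 1: "integrable lborel (\<lambda>u. complex_of_real (xi_kernel u))"
    using xi_kernel_fourier(1)[of 0] by simp
  show "integrable lborel xi_kernel"
    using integrable_Re[OF 1] by simp
qed

lemma integrable_xi_kernel_convolution: "integrable lborel (\<lambda>u. xi_kernel u * sech_kernel m (c - u))"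
proof (rule Bochner_Integration.integrable_bound)
  show "integrable lborel (\<lambda>u. 2 * fact m * xi_kernel u)" using integrable_xi_kernel(2) by simp
  show "AE u in lborel. norm (xi_kernel u * sech_kernel m (c - u)) \<le> norm (2 * fact m * xi_kernel u)"
  proof (rule AE_I2)
    fix u show "norm (xi_kernel u * sech_kernel m (c - u)) \<le> norm (2 * fact m * xi_kernel u)"
      using mult_left_mono[OF sech_kernel_bounded[of m "c - u"], of "\<bar>xi_kernel u\<bar>"] by (simp add: abs_mult mult_ac)
  qed
qed measurable

text \<open>
  The substitution \<open>v = exp u\<close>. Its factor \<open>exp u\<close>, the weight \<open>exp (u/2)\<close> in \<open>xi_kernel\<close> and the numerator of
  \<open>sech_kernel\<close> cancel up to the factor \<open>exp x\<close>.
\<close>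
lemma gauss_defect_integral:
  defines "G \<equiv> \<lambda>m x v. fact m * v ^ m / (exp (2 * x) + v) ^ Suc m * gauss_defect v"
  shows "set_integrable lborel {0<..} (G m x)"
    and "exp x * (LINT v:{0<..}|lborel. G m x v) = 1 / 2 * (\<integral>u. xi_kernel u * sech_kernel m (2 * x - u) \<partial>lborel)"
proof -
  have val: "exp u *\<^sub>R G m x (exp u) = exp (- x) / 2 * (xi_kernel u * sech_kernel m (2 * x - u))" for u
  proof -
    define y where "y = exp (2 * x - u)"
    have y: "1 + y > 0" by (simp add: y_def add_pos_pos)
    have 1: "exp (2 * x) + exp u = exp u * (1 + y)"
      by (simp add: y_def distrib_left exp_diff)
    have 2: "exp (- x) * exp (u / 2) * exp ((2 * x - u) / 2) = 1"
      by (simp add: exp_add[symmetric] field_simps)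
    have "exp u *\<^sub>R G m x (exp u) = fact m * (exp u) ^ Suc m / (exp u * (1 + y)) ^ Suc m * gauss_defect (exp u)"
      unfolding G_def 1 by simp
    also have "\<dots> = fact m / (1 + y) ^ Suc m * gauss_defect (exp u)"
      using y by (simp only: power_mult_distrib) simp
    also have "\<dots> = (exp (- x) * exp (u / 2) * exp ((2 * x - u) / 2)) * (fact m / (1 + y) ^ Suc m * gauss_defect (exp u))"
      unfolding 2 by simp
    also have "\<dots> = exp (- x) / 2 * (xi_kernel u * sech_kernel m (2 * x - u))"
      unfolding xi_kernel_def sech_kernel_def y_def[symmetric] by simp
    finally show ?thesis .
  qed
  have [measurable]: "G m x \<in> borel_measurable borel"
    unfolding G_def gauss_defect_def[abs_def] by measurable
  have range: "range (exp :: real \<Rightarrow> real) = {0<..}"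
    by (auto simp: image_iff) (metis exp_ln)
  have deriv: "(exp has_field_derivative exp u) (at u)" for u :: real by (rule DERIV_exp)
  note subst = lborel_integral_substitution_UNIV[of exp exp "G m x", OF deriv _ exp_gt_zero]
  show "set_integrable lborel {0<..} (G m x)"
    using subst(1) integrable_xi_kernel_convolution[of m "2 * x"] unfolding range val by (simp add: inj_def)
  have "(LINT v:{0<..}|lborel. G m x v) = (\<integral>u. exp (- x) / 2 * (xi_kernel u * sech_kernel m (2 * x - u)) \<partial>lborel)"
    using subst(2) unfolding range val by (simp add: inj_def)
  also have "\<dots> = exp (- x) / 2 * (\<integral>u. xi_kernel u * sech_kernel m (2 * x - u) \<partial>lborel)"
    by (rule integral_mult_right_zero)
  finally have eq: "(LINT v:{0<..}|lborel. G m x v) = exp (- x) / 2 * (\<integral>u. xi_kernel u * sech_kernel m (2 * x - u) \<partial>lborel)" .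
  show "exp x * (LINT v:{0<..}|lborel. G m x v) = 1 / 2 * (\<integral>u. xi_kernel u * sech_kernel m (2 * x - u) \<partial>lborel)"
    unfolding eq by (simp add: exp_minus)
qed

lemma psi_bar_gaussian_integral:
  fixes m :: nat and x :: real
  defines "f \<equiv> \<lambda>t::real. t ^ m * psi_bar m t * exp (- pi * t\<^sup>2 * exp (4 * x))"
  shows "set_integrable lborel {0<..} f"
    and "(-1) ^ m * exp x * (LINT t:{0<..}|lborel. f t) = 1 / 2 * (\<integral>u. xi_kernel u * sech_kernel m (2 * x - u) \<partial>lborel)"
proof -
  define b where "b = exp (2 * x)"
  have b: "b > 0" "exp (4 * x) = b\<^sup>2" by (simp_all add: b_def power2_eq_square flip: exp_add)
  define G where "G v = fact m * v ^ m / (b + v) ^ Suc m * gauss_defect v" for v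
  have G_int: "set_integrable lborel {0<..} G" 
    and G_val: "exp x * (LINT v:{0<..}|lborel. G v) = 1 / 2 * (\<integral>u. xi_kernel u * sech_kernel m (2 * x - u) \<partial>lborel)"
    using gauss_defect_integral[where m = m and x = x] by (simp_all add: G_def[abs_def] b_def)
  have G_nonneg: "indicator {0<..} v * G v \<ge> 0" for v
    using b euler_defect_gaussian(2)[of v] by (auto simp: G_def indicator_def)
  let ?g = "\<lambda>t. indicator {0<..} t * ((-1) ^ m * t ^ m * psi_bar m t * exp (- pi * t\<^sup>2 * b\<^sup>2))"
  have g_eq: "?g t = (-1) ^ m * (indicator {0<..} t *\<^sub>R f t)" for t
    unfolding f_def b(2) by (simp add: mult_ac)
  have "has_bochner_integral lborel ?g (LINT v:{0<..}|lborel. G v)"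
  proof (rule has_bochner_integral_nn_integral)
    show "?g \<in> borel_measurable lborel" using nn_integral_psi_bar_gaussian(1)[OF b(1), of m] by simp
    show "AE t in lborel. 0 \<le> ?g t"
      using euler_defect_reciprocal_power(2)[of _ m] by (auto simp: indicator_def intro!: AE_I2)
    show "0 \<le> (LINT v:{0<..}|lborel. G v)"
      unfolding set_lebesgue_integral_def using G_nonneg by (intro Bochner_Integration.integral_nonneg) simp
    have "(\<integral>\<^sup>+t. ennreal (?g t) \<partial>lborel) = (\<integral>\<^sup>+v. ennreal (indicator {0<..} v * G v) \<partial>lborel)"
      unfolding nn_integral_psi_bar_gaussian(2)[OF b(1), of m] G_def ..
    also have "\<dots> = ennreal (LINT v:{0<..}|lborel. G v)"
      using G_int G_nonneg unfolding set_integrable_def set_lebesgue_integral_def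
      by (subst nn_integral_eq_integral) auto
    finally show "(\<integral>\<^sup>+t. ennreal (?g t) \<partial>lborel) = ennreal (LINT v:{0<..}|lborel. G v)" .
  qed
  from has_bochner_integral_mult_right[OF this, of "(-1) ^ m"]
  have f: "has_bochner_integral lborel (\<lambda>t. indicator {0<..} t *\<^sub>R f t) ((-1) ^ m * (LINT v:{0<..}|lborel. G v))"
    unfolding g_eq by (simp add: mult.assoc[symmetric] power_add[symmetric] flip: mult_2)
  thus "set_integrable lborel {0<..} f" by (simp add: set_integrable_def has_bochner_integral_iff)
  have "(LINT t:{0<..}|lborel. f t) = (-1) ^ m * (LINT v:{0<..}|lborel. G v)"
    using f by (simp add: set_lebesgue_integral_def has_bochner_integral_iff)
  hence "(-1) ^ m * exp x * (LINT t:{0<..}|lborel. f t) = ((-1) ^ m * (-1) ^ m) * (exp x * (LINT v:{0<..}|lborel. G v))"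
    by (simp only: mult_ac)
  also have "(-1) ^ m * (-1) ^ m = (1 :: real)" by (simp flip: power_add mult_2)
  finally show "(-1) ^ m * exp x * (LINT t:{0<..}|lborel. f t) = 1 / 2 * (\<integral>u. xi_kernel u * sech_kernel m (2 * x - u) \<partial>lborel)"
    using G_val by simp
qed

text \<open>
  Inserting the Fourier integral of \<open>\<Xi>\<close> and integrating over \<open>t\<close> first leaves the transform of
  \<open>(1/2 + it)\<^sub>m / cosh (\<pi> t)\<close> at \<open>2x + u\<close>; the evenness of \<open>H\<close> changes the sign of \<open>u\<close>.
\<close>
lemma xi_sech_fubini:
  defines "M \<equiv> \<lambda>t. \<integral>u. complex_of_real (xi_kernel u) * exp (\<i> * of_real t * of_real u) \<partial>lborel"
  shows "integrable lborel (\<lambda>t. sech_poly m t * exp (2 * \<i> * of_real x * of_real t) * M t)"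
    and "(\<integral>t. sech_poly m t * exp (2 * \<i> * of_real x * of_real t) * M t \<partial>lborel) = 
      of_real (\<integral>u. xi_kernel u * sech_kernel m (2 * x - u) \<partial>lborel)"
proof -
  define \<Phi> where "\<Phi> t u = sech_poly m t * exp (2 * \<i> * of_real x * of_real t) * (complex_of_real (xi_kernel u) * exp (\<i> * of_real t * of_real u))" for t u :: real
  have [measurable]: "case_prod \<Phi> \<in> borel_measurable (lborel \<Otimes>\<^sub>M lborel)"
    unfolding \<Phi>_def by measurable
  have norm_\<Phi>: "norm (\<Phi> t u) = norm (sech_poly m t) * \<bar>xi_kernel u\<bar>" for t u
    by (simp add: \<Phi>_def norm_mult)
  have int_pair: "integrable (lborel \<Otimes>\<^sub>M lborel) (case_prod \<Phi>)"
  proof (rule lborel_pair.Fubini_integrable)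
    show "integrable lborel (\<lambda>t. \<integral>u. norm (case_prod \<Phi> (t, u)) \<partial>lborel)"
      using integrable_sech_poly[of m] by (simp add: norm_\<Phi>)
    show "AE t in lborel. integrable lborel (\<lambda>u. case_prod \<Phi> (t, u))"
      using xi_kernel_fourier(1) by (intro AE_I2) (simp add: \<Phi>_def)
  qed measurable
  have inner: "(\<integral>u. \<Phi> t u \<partial>lborel) = sech_poly m t * exp (2 * \<i> * of_real x * of_real t) * M t" for t
    unfolding \<Phi>_def M_def by (rule integral_mult_right_zero)
  show "integrable lborel (\<lambda>t. sech_poly m t * exp (2 * \<i> * of_real x * of_real t) * M t)"
    using lborel_pair.integrable_fst[OF int_pair] unfolding inner .
  have "(\<integral>t. sech_poly m t * exp (2 * \<i> * of_real x * of_real t) * M t \<partial>lborel) = (\<integral>u. \<integral>t. \<Phi> t u \<partial>lborel \<partial>lborel)"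
    unfolding inner[symmetric] by (rule lborel_pair.Fubini_integral[OF int_pair, symmetric])
  also have "\<dots> = (\<integral>u. of_real (xi_kernel u * sech_kernel m (2 * x + u)) \<partial>lborel)"
  proof (rule Bochner_Integration.integral_cong)
    fix u :: real
    have "(\<integral>t. \<Phi> t u \<partial>lborel) = (\<integral>t. of_real (xi_kernel u) * (sech_poly m t * exp (\<i> * of_real (2 * x + u) * of_real t)) \<partial>lborel)"
      by (intro Bochner_Integration.integral_cong) (simp_all add: \<Phi>_def algebra_simps flip: exp_add)
    also have "\<dots> = of_real (xi_kernel u) * of_real (sech_kernel m (2 * x + u))"
      unfolding sech_kernel_def fourier_sech_poly[symmetric] by (rule integral_mult_right_zero)
    finally show "(\<integral>t. \<Phi> t u \<partial>lborel) = of_real (xi_kernel u * sech_kernel m (2 * x + u))" by simp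
  qed simp
  also have "\<dots> = of_real (\<integral>u. xi_kernel u * sech_kernel m (2 * x + u) \<partial>lborel)"
    by (rule integral_complex_of_real)
  also have "(\<integral>u. xi_kernel u * sech_kernel m (2 * x + u) \<partial>lborel) = (\<integral>u. xi_kernel u * sech_kernel m (2 * x - u) \<partial>lborel)"
    using lborel_integral_real_affine[of "-1" "\<lambda>u. xi_kernel u * sech_kernel m (2 * x + u)" 0] by (simp add: xi_kernel_even)
  finally show "(\<integral>t. sech_poly m t * exp (2 * \<i> * of_real x * of_real t) * M t \<partial>lborel) = 
      of_real (\<integral>u. xi_kernel u * sech_kernel m (2 * x - u) \<partial>lborel)" .
qed

lemma Gamma_quotient_pochhammer:
  assumes "Re z > 0"
  shows "Gamma (z + of_nat m) / Gamma z = pochhammer z m"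
proof -
  have "z \<notin> \<int>\<^sub>\<le>\<^sub>0" using assms by (auto elim!: nonpos_Ints_cases)
  thus ?thesis by (simp add: pochhammer_Gamma)
qed

theorem theorem1p1:
  fixes m :: nat and x :: real
  defines "f \<equiv> \<lambda>t::real. t ^ m * psi_bar m t * exp (- pi * t\<^sup>2 * exp (4 * x))"
    and "g \<equiv> \<lambda>t::real.
      riemann_Xi (of_real t) / of_real (cosh (pi * t) * (t\<^sup>2 + 1 / 4)) *
      (Gamma (1 / 2 - \<i> * of_real t + of_nat m) / Gamma (1 / 2 - \<i> * of_real t) *
         exp (- 2 * \<i> * of_real x * of_real t) +
       Gamma (1 / 2 + \<i> * of_real t + of_nat m) / Gamma (1 / 2 + \<i> * of_real t) *
         exp (2 * \<i> * of_real x * of_real t))"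
  shows "set_integrable lborel {0<..} f \<and> set_integrable lborel {0<..} g \<and>
    complex_of_real ((-1) ^ m * exp x * (LINT t:{0<..}|lborel. f t)) =
      1 / 2 * (LINT t:{0<..}|lborel. g t)"
proof (intro conjI)
  define M where "M t = (\<integral>u. complex_of_real (xi_kernel u) * exp (\<i> * of_real t * of_real u) \<partial>lborel)" for t :: real
  define F where "F t = sech_poly m t * exp (2 * \<i> * of_real x * of_real t) * M t" for t :: real
  have M_even: "M (- t) = M t" for t
    using lborel_integral_real_affine[of "-1" "\<lambda>u. complex_of_real (xi_kernel u) * exp (\<i> * of_real t * of_real u)" 0]
    by (simp add: M_def xi_kernel_even)
  have F_int: "integrable lborel F"
    and F_val: "(\<integral>t. F t \<partial>lborel) = of_real (\<integral>u. xi_kernel u * sech_kernel m (2 * x - u) \<partial>lborel)"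
    using xi_sech_fubini[where m = m and x = x] unfolding F_def[abs_def] M_def by auto
  have g_eq: "g t = F t + F (- t)" for t
  proof -
    have "t\<^sup>2 + 1 / 4 > 0" by (simp add: add_nonneg_pos)
    hence nz: "complex_of_real (t\<^sup>2 + 1 / 4) \<noteq> 0" "complex_of_real (cosh (pi * t)) \<noteq> 0"
      by (simp_all only: of_real_eq_0_iff) auto
    have "riemann_Xi (of_real t) / of_real (cosh (pi * t) * (t\<^sup>2 + 1 / 4)) = M t / of_real (cosh (pi * t))"
      unfolding riemann_Xi_fourier M_def[symmetric] of_real_mult using nz by (simp del: of_real_add)
    moreover have "Gamma (1 / 2 - \<i> * of_real t + of_nat m) / Gamma (1 / 2 - \<i> * of_real t) = pochhammer (1 / 2 + \<i> * of_real (- t)) m"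
      using Gamma_quotient_pochhammer[of "1 / 2 - \<i> * of_real t" m] by simp
    moreover have "Gamma (1 / 2 + \<i> * of_real t + of_nat m) / Gamma (1 / 2 + \<i> * of_real t) = pochhammer (1 / 2 + \<i> * of_real t) m"
      by (rule Gamma_quotient_pochhammer) simp
    ultimately show ?thesis
      unfolding g_def F_def sech_poly_def M_even by (simp add: algebra_simps add_divide_distrib)
  qed
  have pos: "integrable lborel (\<lambda>t. indicator {0<..} t *\<^sub>R F t)"
    using integrable_mult_indicator[of "{0<..}" lborel F] F_int by simp
  have F_neg_int: "integrable lborel (\<lambda>t. F (- t))"
    using lborel_integrable_real_affine[OF F_int, of "-1" 0] by simp
  have neg: "integrable lborel (\<lambda>t. indicator {0<..} t *\<^sub>R F (- t))"
    using integrable_mult_indicator[of "{0<..}" lborel "\<lambda>t. F (- t)"] F_neg_int by simp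
  have F_meas: "F \<in> borel_measurable borel" using borel_measurable_integrable[OF F_int] by simp
  show "set_integrable lborel {0<..} f" unfolding f_def by (rule psi_bar_gaussian_integral(1))
  show "set_integrable lborel {0<..} g"
    using pos neg by (simp add: set_integrable_def g_eq scaleR_add_right)
  have "(LINT t:{0<..}|lborel. g t) = (\<integral>t. F t \<partial>lborel)"
    using pos neg integral_split_at_0(2)[OF pos neg F_meas]
    by (simp add: set_lebesgue_integral_def g_eq scaleR_add_right)
  thus "complex_of_real ((-1) ^ m * exp x * (LINT t:{0<..}|lborel. f t)) = 1 / 2 * (LINT t:{0<..}|lborel. g t)"
    unfolding F_val psi_bar_gaussian_integral(2)[where m = m and x = x, folded f_def] by simp
qed

end
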